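(* Let $g_0\in\mathcal M(M)$ and $\mathcal N=\mathbb R_{>0}\,g_0=\{rg_0:r>0\}\subset\mathcal M(M)$. If $P$, viewed as a $\binom11$-tensor field on $\mathcal M(M)$, restricts to the submanifold $\mathcal N$ in the sense that $P_gh$ is tangential to $\mathcal N$ for all $g\in\mathcal N$ and $h\in T_g\mathcal N$, then the following statements are equivalent. (a) $\mathcal N$ is totally geodesic. (b) $(D_{(g,\cdot)}P\,h)^*(k)$ is tangential to $\mathcal N$ for all $g\in\mathcal N$ and $h,k\in T_g\mathcal N$. (c) $(D_{(g,m)}P)(h)$ is $\tilde g^0_2$-normal to $\mathcal N$ for all $g\in\mathcal N$, $h\in T_g\mathcal N$, and $m\in T_g\mathcal M(M)$ such that $m$ is $\tilde g^0_2$-normal to $\mathcal N$. If $P$ restricts to $\mathcal N$ and (a)–(c) hold, then there are $\Psi,f:\mathbb R_{>0}\to\mathbb R$ such that $$P_{rg_0}(g_0)=\Psi(r)g_0,\qquad \big((D_{(rg_0,\cdot)}P)g_0\big)^*(g_0)=f(r)g_0$$ holds for all $r>0$. Then the path $g(t,\cdot)=r(t)g_0$ is a geodesic in $\mathcal M(M)$ (with respect to $G^P$) if and only if the function $r$ satisfies $$r''\,\Psi(r)=r'^2\Big(\tfrac12f(r)-\Psi'(r)+\big(1-\tfrac{\dim(M)}4\big)\Psi(r)r^{-1}\Big).$$ Along these geodesics the conserved quantity vanishes, i.e. $(\nabla^*P_gg_t)\operatorname{vol}(g)=0$.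
   Context: $M$ is a compact smooth manifold. $\mathcal M(M)=\Gamma(S^2_+T^*M)$ is the space of all smooth Riemannian metrics on $M$, an open convex subset of the Fréchet space $\Gamma(S^2T^*M)$ of smooth symmetric $\binom02$-tensor fields, so $T_g\mathcal M(M)=\Gamma(S^2T^*M)$. For symmetric $h,k$: $g^0_2(h,k)=\operatorname{Tr}(g^{-1}hg^{-1}k)$ and $\tilde g^0_2(h,k)=\int_Mg^0_2(h,k)\operatorname{vol}(g)$, where $\operatorname{vol}(g)$ is the volume density. $D_{(g,m)}F$ denotes the directional derivative $\partial_t|_0F(g+tm)$. $\nabla^*B=-\operatorname{Tr}^g(\nabla B)$ is the adjoint of the Levi-Civita covariant derivative $\nabla$ of $g$ (the trace contracts the first two slots with $g^{-1}$). $P_g:\Gamma(S^2T^*M)\to\Gamma(S^2T^*M)$ is a positive, symmetric, bijective pseudo-differential operator of order $2p\ge0$, depending smoothly on $g$, and $G^P_g(h,k)=\int_M g^0_2(P_gh,k)\operatorname{vol}(g)$ is the induced Riemannian metric on $\mathcal M(M)$. It is assumed that there is an adjoint $(D_{(g,\cdot)}P\,h)^*(k)\in\Gamma(S^2T^*M)$, smooth in $(g,h,k)$ and bilinear in $(h,k)$, such that $$\int_M g^0_2\big((D_{(g,m)}P)h,k\big)\operatorname{vol}(g)=\int_M g^0_2\big(m,(D_{(g,\cdot)}P\,h)^*(k)\big)\operatorname{vol}(g)\quad\text{for all } m\in\Gamma(S^2T^*M).$$ Geodesics of $G^P$ are the solutions of $$(P_gg_t)_t=\tfrac12(D_{(g,\cdot)}P\,g_t)^*(g_t)+\tfrac14\,g\operatorname{Tr}(g^{-1}P_gg_t\,g^{-1}g_t)+\tfrac12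 g_tg^{-1}P_gg_t+\tfrac12P_gg_t\,g^{-1}g_t-\tfrac12\operatorname{Tr}(g^{-1}g_t)P_gg_t .$$ Writing this equation as $g_{tt}=\Gamma_g(g_t,g_t)$ with $\Gamma_g$ symmetric bilinear, $\mathcal N$ is totally geodesic if $\Gamma_g(h,k)$ is tangential to $\mathcal N$ for all $g\in\mathcal N$ and $h,k\in T_g\mathcal N$. "Tangential to $\mathcal N$" at $g\in\mathcal N$ means lying in $T_g\mathcal N=\mathbb R\,g_0$. *)

theory Defs
  imports "HOL-Analysis.Analysis"
begin

section \<open>Smooth functions on open subsets of Euclidean spaces\<close>

primrec dderivs :: "'a::real_normed_vector list \<Rightarrow> ('a \<Rightarrow> 'b::real_normed_vector) \<Rightarrow> 'a \<Rightarrow> 'b" where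
  "dderivs [] f = f"
| "dderivs (v # vs) f = dderivs vs (\<lambda>x. frechet_derivative f (at x) v)"

text \<open>For open \<open>S\<close> this is \<open>C\<^sup>\<infinity>\<close>: every iterated directional derivative exists
  and is (Frechet) differentiable, hence continuous. It is only used for open \<open>S\<close>.\<close>

definition smooth_on :: "'a::real_normed_vector set \<Rightarrow> ('a \<Rightarrow> 'b::real_normed_vector) \<Rightarrow> bool" where
  "smooth_on S f \<longleftrightarrow> (\<forall>vs. \<forall>x\<in>S. dderivs vs f differentiable (at x))"


section \<open>Smooth manifolds without boundary\<close>

text \<open>The manifold is (the universe of) a Hausdorff space \<open>'m\<close>; its dimension is \<open>CARD('n)\<close>.
  A chart \<open>(U, \<kappa>)\<close> consists of its open domain and of a map that is relevant on \<open>U\<close> only.\<close>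

type_synonym ('m, 'n) chart = "'m set \<times> ('m \<Rightarrow> real^'n)"

abbreviation cdom :: "('m, 'n) chart \<Rightarrow> 'm set" where "cdom c \<equiv> fst c"
abbreviation cmap :: "('m, 'n) chart \<Rightarrow> 'm \<Rightarrow> real^'n" where "cmap c \<equiv> snd c"
abbreviation cimage :: "('m, 'n) chart \<Rightarrow> (real^'n) set" where "cimage c \<equiv> cmap c ` cdom c"
abbreviation cinv :: "('m, 'n) chart \<Rightarrow> real^'n \<Rightarrow> 'm" where "cinv c \<equiv> inv_into (cdom c) (cmap c)"

definition is_chart :: "('m::t2_space, 'n::finite) chart \<Rightarrow> bool" where
  "is_chart c \<longleftrightarrow> open (cdom c) \<and> open (cimage c) \<and>
     homeomorphism (cdom c) (cimage c) (cmap c) (cinv c)"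

definition compatible :: "('m::t2_space, 'n::finite) chart \<Rightarrow> ('m, 'n) chart \<Rightarrow> bool" where
  "compatible c d \<longleftrightarrow>
     smooth_on (cmap c ` (cdom c \<inter> cdom d)) (cmap d \<circ> cinv c) \<and>
     smooth_on (cmap d ` (cdom c \<inter> cdom d)) (cmap c \<circ> cinv d)"

text \<open>A smooth structure is a maximal smooth atlas. Chart domains need not be connected.\<close>

definition smooth_structure :: "('m::t2_space, 'n::finite) chart set \<Rightarrow> bool" where
  "smooth_structure A \<longleftrightarrow>
     (\<forall>c\<in>A. is_chart c) \<and> (\<Union>c\<in>A. cdom c) = UNIV \<and>
     (\<forall>c\<in>A. \<forall>d\<in>A. compatible c d) \<and>
     (\<forall>c. is_chart c \<and> (\<forall>d\<in>A. compatible c d) \<longrightarrow> c \<in> A)"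


section \<open>Symmetric tensor fields and Riemannian metrics\<close>

text \<open>The tangent space at \<open>x\<close> is modelled as \<open>\<real>\<^sup>n\<close> by means of one fixed chart around \<open>x\<close>; these
  reference charts are chosen independently for every point, so that the resulting
  frame is neither continuous nor otherwise distinguished. A (0,2)-tensor at \<open>x\<close> is thus a
  matrix, and smoothness is defined through the components of the field with respect to a
  chart \<open>c\<close>, which are obtained from this matrix by the Jacobian matrix of the change of
  coordinates from \<open>c\<close> to the reference chart.\<close>

type_synonym ('m, 'n) tensor2 = "'m \<Rightarrow> real^'n^'n"

definition chart_at :: "('m::t2_space, 'n::finite) chart set \<Rightarrow> 'm \<Rightarrow> ('m, 'n) chart" where
  "chart_at A x = (SOME c. c \<in> A \<and> x \<in> cdom c)"

definition jacobian_at ::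
  "('m::t2_space, 'n::finite) chart set \<Rightarrow> ('m, 'n) chart \<Rightarrow> real^'n \<Rightarrow> real^'n^'n" where
  "jacobian_at A c y =
     matrix (frechet_derivative (cmap (chart_at A (cinv c y)) \<circ> cinv c) (at y))"

definition components ::
  "('m::t2_space, 'n::finite) chart set \<Rightarrow> ('m, 'n) chart \<Rightarrow> ('m, 'n) tensor2 \<Rightarrow> real^'n \<Rightarrow> real^'n^'n" where
  "components A c h y = transpose (jacobian_at A c y) ** h (cinv c y) ** jacobian_at A c y"

text \<open>Components in different charts are related by the tensor transformation law.\<close>

lemma components_change:
  fixes A :: "('m::t2_space, 'n::finite) chart set"
  assumes A: "smooth_structure A" and c: "c \<in> A" and d: "d \<in> A"
    and x: "x \<in> cdom c" "x \<in> cdom d"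
  defines "J \<equiv> matrix (frechet_derivative (cmap d \<circ> cinv c) (at (cmap c x)))"
  shows "components A c h (cmap c x) = transpose J ** components A d h (cmap d x) ** J"
proof -
  define e where "e = chart_at A x"
  have "e \<in> A \<and> x \<in> cdom e"
    unfolding e_def chart_at_def by (rule someI[of _ c]) (use c x in blast)
  then have e: "e \<in> A" "x \<in> cdom e" by auto
  have ch: "open (cdom b)" "open (cimage b)" "homeomorphism (cdom b) (cimage b) (cmap b) (cinv b)"
    if "b \<in> A" for b
    using A that unfolding smooth_structure_def is_chart_def by blast+
  have inv: "cinv b (cmap b z) = z" if "b \<in> A" "z \<in> cdom b" for b z
    using ch(3)[OF that(1)] that(2) by (simp add: homeomorphism_def)
  have diff: "(cmap b \<circ> cinv a) differentiable (at (cmap a x))"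
    if "a \<in> A" "b \<in> A" "x \<in> cdom a" "x \<in> cdom b" for a b
  proof -
    have "smooth_on (cmap a ` (cdom a \<inter> cdom b)) (cmap b \<circ> cinv a)"
      using A that unfolding smooth_structure_def compatible_def by blast
    moreover have "cmap a x \<in> cmap a ` (cdom a \<inter> cdom b)" using that by blast
    ultimately have "dderivs [] (cmap b \<circ> cinv a) differentiable (at (cmap a x))"
      unfolding smooth_on_def by blast
    then show ?thesis by simp
  qed
  let ?F = "cmap d \<circ> cinv c" and ?G = "cmap e \<circ> cinv d" and ?H = "cmap e \<circ> cinv c"
  define F' where "F' = frechet_derivative ?F (at (cmap c x))"
  define G' where "G' = frechet_derivative ?G (at (cmap d x))"
  have F: "(?F has_derivative F') (at (cmap c x))"
    using diff[OF c d x] unfolding F'_def frechet_derivative_works .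
  have G: "(?G has_derivative G') (at (?F (cmap c x)))"
    using diff[OF d e(1) x(2) e(2)] inv[OF c x(1)] unfolding G'_def frechet_derivative_works by simp
  have comp: "((?G \<circ> ?F) has_derivative (G' \<circ> F')) (at (cmap c x))"
    by (rule diff_chain_at[OF F G])
  let ?S = "cmap c ` (cdom c \<inter> cdom d)"
  have opS: "open ?S"
  proof -
    have "openin (top_of_set (cdom c)) (cdom c \<inter> cdom d)"
      using ch(1)[OF d] by (simp add: openin_open_Int)
    then have "openin (top_of_set (cimage c)) ?S"
      using homeomorphism_imp_open_map[OF ch(3)[OF c]] by blast
    then show ?thesis using ch(2)[OF c] openin_open_eq by blast
  qed
  have "(?H has_derivative (G' \<circ> F')) (at (cmap c x))"
  proof (rule has_derivative_transform_within_open[OF comp opS])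
    show "cmap c x \<in> ?S" using x by blast
    show "(?G \<circ> ?F) y = ?H y" if "y \<in> ?S" for y
      using that inv c d by auto
  qed
  then have H: "frechet_derivative ?H (at (cmap c x)) = G' \<circ> F'"
    by (rule frechet_derivative_at[symmetric])
  have lin: "linear F'" "linear G'"
    using F G has_derivative_linear by blast+
  have "jacobian_at A c (cmap c x) = matrix (G' \<circ> F')"
    unfolding jacobian_at_def inv[OF c x(1)] e_def[symmetric] H ..
  also have "\<dots> = matrix G' ** matrix F'" using lin by (simp add: matrix_compose)
  also have "matrix G' = jacobian_at A d (cmap d x)"
    unfolding jacobian_at_def inv[OF d x(2)] e_def[symmetric] G'_def ..
  also have "matrix F' = J" unfolding J_def F'_def ..
  finally show ?thesis
    unfolding components_def inv[OF c x(1)] inv[OF d x(2)]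
    by (simp add: matrix_transpose_mul matrix_mul_assoc)
qed

text \<open>\<open>sym_fields A\<close> is \<open>\<Gamma>(S\<^sup>2T\<^sup>*M)\<close>, \<open>metrics A\<close> is \<open>\<M>(M)\<close>.\<close>

definition sym_fields :: "('m::t2_space, 'n::finite) chart set \<Rightarrow> ('m, 'n) tensor2 set" where
  "sym_fields A = {h. (\<forall>x. transpose (h x) = h x) \<and>
     (\<forall>c\<in>A. smooth_on (cimage c) (components A c h))}"

definition metrics :: "('m::t2_space, 'n::finite) chart set \<Rightarrow> ('m, 'n) tensor2 set" where
  "metrics A = {g \<in> sym_fields A. \<forall>x v. v \<noteq> 0 \<longrightarrow> v \<bullet> (g x *v v) > 0}"

definition lin_on_fields ::
  "('m::t2_space, 'n::finite) chart set \<Rightarrow> (('m, 'n) tensor2 \<Rightarrow> ('m, 'n) tensor2) \<Rightarrow> bool" where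
  "lin_on_fields A L \<longleftrightarrow>
     (\<forall>h\<in>sym_fields A. L h \<in> sym_fields A) \<and>
     (\<forall>h\<in>sym_fields A. \<forall>k\<in>sym_fields A. L (\<lambda>x. h x + k x) = (\<lambda>x. L h x + L k x)) \<and>
     (\<forall>h\<in>sym_fields A. \<forall>a::real. L (\<lambda>x. a *\<^sub>R h x) = (\<lambda>x. a *\<^sub>R L h x))"


section \<open>Integration with respect to the volume density\<close>

text \<open>The integral of \<open>f\<close> against \<open>vol(g)\<close> is computed by cutting \<open>M\<close> into finitely many
  Borel cells, each of which is relatively compact in a chart domain, and by integrating in
  each cell against the density \<open>sqrt (det g\<^sub>i\<^sub>j)\<close> of that chart. By the transformation formula the result
  does not depend on the cells.\<close>

definition is_cells :: "('m::t2_space, 'n::finite) chart set \<Rightarrow> (('m, 'n) chart \<times> 'm set) set \<Rightarrow> bool" where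
  "is_cells A D \<longleftrightarrow> finite D \<and>
     (\<forall>(c, K)\<in>D. c \<in> A \<and> K \<in> sets borel \<and> (\<exists>C. compact C \<and> K \<subseteq> C \<and> C \<subseteq> cdom c)) \<and>
     (\<forall>p\<in>D. \<forall>q\<in>D. p \<noteq> q \<longrightarrow> snd p \<inter> snd q = {}) \<and>
     (\<Union>p\<in>D. snd p) = UNIV"

definition cells :: "('m::t2_space, 'n::finite) chart set \<Rightarrow> (('m, 'n) chart \<times> 'm set) set" where
  "cells A = (SOME D. is_cells A D)"

lemma is_cells_cells:
  fixes A :: "('m::t2_space, 'n::finite) chart set"
  assumes "compact (UNIV :: 'm set)" "smooth_structure A"
  shows "is_cells A (cells A)"
proof -
  have "\<exists>c V C. c \<in> A \<and> open V \<and> x \<in> V \<and> compact C \<and> V \<subseteq> C \<and> C \<subseteq> cdom c" for x :: 'm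
  proof -
    obtain c where c: "c \<in> A" "x \<in> cdom c"
      using assms(2) unfolding smooth_structure_def by blast
    have ch: "open (cdom c)" "open (cimage c)" "homeomorphism (cdom c) (cimage c) (cmap c) (cinv c)"
      using assms(2) c(1) unfolding smooth_structure_def is_chart_def by blast+
    have "cmap c x \<in> cimage c" using c(2) by simp
    then obtain e where e: "e > 0" "cball (cmap c x) e \<subseteq> cimage c"
      using ch(2) open_contains_cball by blast
    let ?V = "cinv c ` ball (cmap c x) e" and ?C = "cinv c ` cball (cmap c x) e"
    have "?V \<subseteq> ?C" by (rule image_mono) (rule ball_subset_cball)
    moreover have "?C \<subseteq> cdom c"
      using image_mono[OF e(2), of "cinv c"] homeomorphism_image2[OF ch(3)] by simp
    moreover have "compact ?C"
      by (intro compact_continuous_image compact_cball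
            continuous_on_subset[OF homeomorphism_cont2[OF ch(3)] e(2)])
    moreover have "open ?V"
    proof -
      have "openin (top_of_set (cimage c)) (ball (cmap c x) e)"
        by (rule open_subset[OF subset_trans[OF ball_subset_cball e(2)] open_ball])
      then have "openin (top_of_set (cdom c)) ?V"
        by (rule homeomorphism_imp_open_map[OF homeomorphism_symD[OF ch(3)]])
      then show ?thesis using ch(1) openin_open_eq by blast
    qed
    moreover have "x \<in> ?V"
    proof -
      have "cinv c (cmap c x) = x" using ch(3) c(2) by (simp add: homeomorphism_def)
      then show ?thesis using e(1) by (metis centre_in_ball imageI)
    qed
    ultimately show ?thesis using c(1) by blast
  qed
  then have "\<forall>x::'m. \<exists>c V C. c \<in> A \<and> open V \<and> x \<in> V \<and> compact C \<and> V \<subseteq> C \<and> C \<subseteq> cdom c"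
    by (rule allI)
  from choice[OF this] obtain ch where
    "\<forall>x::'m. \<exists>V C. ch x \<in> A \<and> open V \<and> x \<in> V \<and> compact C \<and> V \<subseteq> C \<and> C \<subseteq> cdom (ch x)" ..
  from choice[OF this] obtain V where
    "\<forall>x::'m. \<exists>C. ch x \<in> A \<and> open (V x) \<and> x \<in> V x \<and> compact C \<and> V x \<subseteq> C \<and> C \<subseteq> cdom (ch x)" ..
  from choice[OF this] obtain C where
    *: "\<forall>x::'m. ch x \<in> A \<and> open (V x) \<and> x \<in> V x \<and> compact (C x) \<and> V x \<subseteq> C x \<and> C x \<subseteq> cdom (ch x)" ..
  have "UNIV \<subseteq> (\<Union>x\<in>UNIV. V x)" using * by blast
  moreover have "open (V x)" for x using * by simp
  ultimately obtain X where X: "finite X" "UNIV \<subseteq> (\<Union>x\<in>X. V x)"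
    using compactE_image[OF assms(1), of UNIV V] by metis
  obtain n :: nat and f where f: "X = f ` {i. i < n}"
    using finite_imp_nat_seg_image_inj_on[OF X(1)] by metis
  define W where "W = disjointed (\<lambda>i. V (f i))"
  define D where "D = (\<lambda>i. (ch (f i), W i)) ` {0..<n}"
  have "X = f ` {0..<n}" using f by (simp add: atLeast0LessThan lessThan_def)
  then have "(\<Union>i\<in>{0..<n}. V (f i)) = (\<Union>x\<in>X. V x)" by simp
  then have "(\<Union>i\<in>{0..<n}. W i) = UNIV"
    unfolding W_def finite_UN_disjointed_eq using X(2) by (metis top.extremum_uniqueI)
  moreover have "W i \<inter> W j = {}" if "i \<noteq> j" for i j
    using disjoint_family_onD[OF disjoint_family_disjointed UNIV_I UNIV_I that] unfolding W_def .
  moreover have "W i \<in> sets borel" for i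
    unfolding W_def disjointed_def using spec[OF *]
    by (intro sets.Diff sets.finite_UN finite_atLeastLessThan borel_open) simp_all
  moreover have "W i \<subseteq> C (f i)" for i
    using spec[OF *, of "f i"] disjointed_subset[of "\<lambda>i. V (f i)" i] unfolding W_def
    by (meson subset_trans)
  ultimately have W: "(\<Union>i\<in>{0..<n}. W i) = UNIV" "\<And>i j. i \<noteq> j \<Longrightarrow> W i \<inter> W j = {}"
    "\<And>i. W i \<in> sets borel" "\<And>i. W i \<subseteq> C (f i)" by blast+
  have "is_cells A D"
    unfolding is_cells_def
  proof (intro conjI ballI impI)
    show "finite D" unfolding D_def by simp
    show "(\<Union>p\<in>D. snd p) = UNIV" unfolding D_def using W(1) by simp
    show "snd p \<inter> snd q = {}" if pq: "p \<in> D" "q \<in> D" "p \<noteq> q" for p q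
    proof -
      obtain i j where "p = (ch (f i), W i)" "q = (ch (f j), W j)"
        using pq unfolding D_def by blast
      then show ?thesis using W(2)[of i j] pq(3) by (cases "i = j") auto
    qed
    show "case p of (c, K) \<Rightarrow> c \<in> A \<and> K \<in> sets borel \<and> (\<exists>C. compact C \<and> K \<subseteq> C \<and> C \<subseteq> cdom c)"
      if p: "p \<in> D" for p
    proof -
      obtain i where "p = (ch (f i), W i)" using p unfolding D_def by blast
      then show ?thesis using W(3,4)[of i] spec[OF *, of "f i"] by auto
    qed
  qed
  then show ?thesis unfolding cells_def by (rule someI)
qed

definition vol_integral ::
  "('m::t2_space, 'n::finite) chart set \<Rightarrow> ('m, 'n) tensor2 \<Rightarrow> ('m \<Rightarrow> real) \<Rightarrow> real" where
  "vol_integral A g f = (\<Sum>(c, K)\<in>cells A.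
     set_lebesgue_integral lborel (cmap c ` K) (\<lambda>y. sqrt (det (components A c g y)) * f (cinv c y)))"

text \<open>\<open>inner02\<close> is \<open>g\<^sup>0\<^sub>2(h,k) = Tr(g\<^sup>-\<^sup>1 h g\<^sup>-\<^sup>1 k)\<close> and \<open>L2_inner\<close> its integral over \<open>M\<close>.\<close>

definition inner02 ::
  "('m, 'n::finite) tensor2 \<Rightarrow> ('m, 'n) tensor2 \<Rightarrow> ('m, 'n) tensor2 \<Rightarrow> 'm \<Rightarrow> real" where
  "inner02 g h k x = trace (matrix_inv (g x) ** h x ** matrix_inv (g x) ** k x)"

definition L2_inner ::
  "('m::t2_space, 'n::finite) chart set \<Rightarrow> ('m, 'n) tensor2 \<Rightarrow> ('m, 'n) tensor2 \<Rightarrow> ('m, 'n) tensor2 \<Rightarrow> real" where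
  "L2_inner A g h k = vol_integral A g (inner02 g h k)"


section \<open>Smooth curves and smooth maps in the space of tensor fields\<close>

text \<open>A curve in the Frechet space of smooth tensor fields is smooth if and only if it is jointly smooth
  as a time dependent tensor field. A map between Frechet spaces (on an open set) is smooth
  if and only if it maps smooth curves to smooth curves (convenient calculus). The smoothness of
  \<open>g \<mapsto> P\<^sub>g\<close> into the linear operators is the smoothness of \<open>(g, h) \<mapsto> P\<^sub>g h\<close>.\<close>

definition smooth_curve ::
  "('m::t2_space, 'n::finite) chart set \<Rightarrow> real set \<Rightarrow> (real \<Rightarrow> ('m, 'n) tensor2) \<Rightarrow> bool" where
  "smooth_curve A I \<gamma> \<longleftrightarrow> (\<forall>t\<in>I. \<gamma> t \<in> sym_fields A) \<and>
     (\<forall>c\<in>A. smooth_on (I \<times> cimage c) (\<lambda>(t, y). components A c (\<gamma> t) y))"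

definition smooth_operator_family ::
  "('m::t2_space, 'n::finite) chart set \<Rightarrow>
   (('m, 'n) tensor2 \<Rightarrow> ('m, 'n) tensor2 \<Rightarrow> ('m, 'n) tensor2) \<Rightarrow> bool" where
  "smooth_operator_family A P \<longleftrightarrow>
     (\<forall>\<gamma> \<eta>. smooth_curve A UNIV \<gamma> \<and> (\<forall>t. \<gamma> t \<in> metrics A) \<and> smooth_curve A UNIV \<eta>
        \<longrightarrow> smooth_curve A UNIV (\<lambda>t. P (\<gamma> t) (\<eta> t)))"

definition smooth_bilinear_family ::
  "('m::t2_space, 'n::finite) chart set \<Rightarrow>
   (('m, 'n) tensor2 \<Rightarrow> ('m, 'n) tensor2 \<Rightarrow> ('m, 'n) tensor2 \<Rightarrow> ('m, 'n) tensor2) \<Rightarrow> bool" where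
  "smooth_bilinear_family A B \<longleftrightarrow>
     (\<forall>g\<in>metrics A. (\<forall>h\<in>sym_fields A. lin_on_fields A (B g h)) \<and>
                    (\<forall>k\<in>sym_fields A. lin_on_fields A (\<lambda>h. B g h k))) \<and>
     (\<forall>\<gamma> \<eta> \<zeta>. smooth_curve A UNIV \<gamma> \<and> (\<forall>t. \<gamma> t \<in> metrics A) \<and>
              smooth_curve A UNIV \<eta> \<and> smooth_curve A UNIV \<zeta>
        \<longrightarrow> smooth_curve A UNIV (\<lambda>t. B (\<gamma> t) (\<eta> t) (\<zeta> t)))"


section \<open>Pseudo-differential operators\<close>

text \<open>The symbol class \<open>S\<^sup>m = S\<^sup>m\<^sub>1\<^sub>,\<^sub>0(\<real>\<^sup>n \<times> \<real>\<^sup>n)\<close>.\<close>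

definition symbol_class :: "real \<Rightarrow> (real^'n::finite \<Rightarrow> real^'n \<Rightarrow> complex) set" where
  "symbol_class m = {a. smooth_on UNIV (\<lambda>(y, \<xi>). a y \<xi>) \<and>
     (\<forall>vs ws. set vs \<subseteq> Basis \<and> set ws \<subseteq> Basis \<longrightarrow>
        (\<exists>C. \<forall>y \<xi>. norm (dderivs (map (\<lambda>v. (v, 0)) vs @ map (\<lambda>w. (0, w)) ws) (\<lambda>(y, \<xi>). a y \<xi>) (y, \<xi>))
                     \<le> C * (1 + norm \<xi>) powr (m - real (length ws))))}"

definition fourier :: "(real^'n::finite \<Rightarrow> real) \<Rightarrow> real^'n \<Rightarrow> complex" where
  "fourier u \<xi> = (LINT z|lborel. cis (- (z \<bullet> \<xi>)) * complex_of_real (u z))"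

definition Op :: "(real^'n::finite \<Rightarrow> real^'n \<Rightarrow> complex) \<Rightarrow> (real^'n \<Rightarrow> real) \<Rightarrow> real^'n \<Rightarrow> complex" where
  "Op a u y = (LINT \<xi>|lborel. cis (y \<bullet> \<xi>) * a y \<xi> * fourier u \<xi>) / complex_of_real ((2 * pi) ^ CARD('n))"

definition test_functions :: "(real^'n::finite) set \<Rightarrow> (real^'n \<Rightarrow> real) set" where
  "test_functions V = {\<phi>. smooth_on UNIV \<phi> \<and>
     compact (closure {y. \<phi> y \<noteq> 0}) \<and> closure {y. \<phi> y \<noteq> 0} \<subseteq> V}"

definition cutoff ::
  "('m::t2_space, 'n::finite) chart \<Rightarrow> (real^'n \<Rightarrow> real) \<Rightarrow> ('m, 'n) tensor2 \<Rightarrow> ('m, 'n) tensor2" where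
  "cutoff c \<psi> h x = (if x \<in> cdom c then \<psi> (cmap c x) *\<^sub>R h x else 0)"

text \<open>A linear operator is pseudo-differential of order \<open>m\<close> if all its localisations \<open>\<phi> L \<psi>\<close> to chart
  domains are matrices of operators with symbols in \<open>S\<^sup>m\<close>. As disconnected
  charts are included, this also forces the Schwartz kernel to be smooth off the diagonal.\<close>

definition pseudo_diff_op ::
  "('m::t2_space, 'n::finite) chart set \<Rightarrow> real \<Rightarrow> (('m, 'n) tensor2 \<Rightarrow> ('m, 'n) tensor2) \<Rightarrow> bool" where
  "pseudo_diff_op A m L \<longleftrightarrow> lin_on_fields A L \<and>
     (\<forall>c\<in>A. \<forall>\<phi>\<in>test_functions (cimage c). \<forall>\<psi>\<in>test_functions (cimage c).
        \<exists>a. (\<forall>i j k l. a i j k l \<in> symbol_class m) \<and>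
          (\<forall>h\<in>sym_fields A. \<forall>y i j.
             complex_of_real (\<phi> y * components A c (L (cutoff c \<psi> h)) y $ i $ j) =
             (\<Sum>k\<in>UNIV. \<Sum>l\<in>UNIV. Op (a i j k l) (\<lambda>z. \<psi> z * components A c h z $ k $ l) y)))"

definition positive_symmetric_op ::
  "('m::t2_space, 'n::finite) chart set \<Rightarrow> ('m, 'n) tensor2 \<Rightarrow> (('m, 'n) tensor2 \<Rightarrow> ('m, 'n) tensor2) \<Rightarrow> bool" where
  "positive_symmetric_op A g L \<longleftrightarrow>
     (\<forall>h\<in>sym_fields A. h \<noteq> (\<lambda>x. 0) \<longrightarrow> L2_inner A g (L h) h > 0) \<and>
     (\<forall>h\<in>sym_fields A. \<forall>k\<in>sym_fields A. L2_inner A g (L h) k = L2_inner A g h (L k))"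


section \<open>The geodesic equation\<close>

text \<open>\<open>deriv_op P g m h = (D\<^bsub>(g,m)\<^esub>P) h\<close>\<close>

definition deriv_op ::
  "(('m, 'n::finite) tensor2 \<Rightarrow> ('m, 'n) tensor2 \<Rightarrow> ('m, 'n) tensor2) \<Rightarrow>
   ('m, 'n) tensor2 \<Rightarrow> ('m, 'n) tensor2 \<Rightarrow> ('m, 'n) tensor2 \<Rightarrow> ('m, 'n) tensor2" where
  "deriv_op P g m h x = vector_derivative (\<lambda>t. P (\<lambda>z. g z + t *\<^sub>R m z) h x) (at 0)"

text \<open>Right-hand side of the geodesic equation for velocity \<open>h\<close> at \<open>g\<close>; \<open>Q g h k\<close> stands for the adjoint
  \<open>(D\<^bsub>(g,\<cdot>)\<^esub>P h)\<^sup>*(k)\<close>.\<close>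

definition geodesic_rhs ::
  "(('m, 'n::finite) tensor2 \<Rightarrow> ('m, 'n) tensor2 \<Rightarrow> ('m, 'n) tensor2) \<Rightarrow>
   (('m, 'n) tensor2 \<Rightarrow> ('m, 'n) tensor2 \<Rightarrow> ('m, 'n) tensor2 \<Rightarrow> ('m, 'n) tensor2) \<Rightarrow>
   ('m, 'n) tensor2 \<Rightarrow> ('m, 'n) tensor2 \<Rightarrow> ('m, 'n) tensor2" where
  "geodesic_rhs P Q g h x =
     (1/2) *\<^sub>R Q g h h x
     + (1/4 * trace (matrix_inv (g x) ** P g h x ** matrix_inv (g x) ** h x)) *\<^sub>R g x
     + (1/2) *\<^sub>R (h x ** matrix_inv (g x) ** P g h x)
     + (1/2) *\<^sub>R (P g h x ** matrix_inv (g x) ** h x)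
     - (1/2 * trace (matrix_inv (g x) ** h x)) *\<^sub>R P g h x"

definition velocity :: "(real \<Rightarrow> ('m, 'n::finite) tensor2) \<Rightarrow> real \<Rightarrow> ('m, 'n) tensor2" where
  "velocity \<gamma> t x = vector_derivative (\<lambda>s. \<gamma> s x) (at t)"

definition is_geodesic ::
  "('m::t2_space, 'n::finite) chart set \<Rightarrow>
   (('m, 'n) tensor2 \<Rightarrow> ('m, 'n) tensor2 \<Rightarrow> ('m, 'n) tensor2) \<Rightarrow>
   (('m, 'n) tensor2 \<Rightarrow> ('m, 'n) tensor2 \<Rightarrow> ('m, 'n) tensor2 \<Rightarrow> ('m, 'n) tensor2) \<Rightarrow>
   real set \<Rightarrow> (real \<Rightarrow> ('m, 'n) tensor2) \<Rightarrow> bool" where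
  "is_geodesic A P Q I \<gamma> \<longleftrightarrow> smooth_curve A I \<gamma> \<and> (\<forall>t\<in>I. \<gamma> t \<in> metrics A) \<and>
     (\<forall>t\<in>I. \<forall>x. ((\<lambda>s. P (\<gamma> s) (velocity \<gamma> s) x) has_vector_derivative
                   geodesic_rhs P Q (\<gamma> t) (velocity \<gamma> t) x) (at t))"

text \<open>Expanding \<open>(P\<^sub>g g\<^sub>t)\<^sub>t = P\<^sub>g g\<^sub>t\<^sub>t + (D\<^bsub>(g,g\<^sub>t)\<^esub>P) g\<^sub>t\<close> and solving for \<open>g\<^sub>t\<^sub>t\<close> gives the quadratic map
  \<open>geodesic_quadratic\<close>; polarisation gives the symmetric bilinear \<open>\<Gamma>\<^sub>g\<close>.\<close>

definition geodesic_quadratic ::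
  "('m::t2_space, 'n::finite) chart set \<Rightarrow>
   (('m, 'n) tensor2 \<Rightarrow> ('m, 'n) tensor2 \<Rightarrow> ('m, 'n) tensor2) \<Rightarrow>
   (('m, 'n) tensor2 \<Rightarrow> ('m, 'n) tensor2 \<Rightarrow> ('m, 'n) tensor2 \<Rightarrow> ('m, 'n) tensor2) \<Rightarrow>
   ('m, 'n) tensor2 \<Rightarrow> ('m, 'n) tensor2 \<Rightarrow> ('m, 'n) tensor2" where
  "geodesic_quadratic A P Q g h =
     inv_into (sym_fields A) (P g) (\<lambda>x. geodesic_rhs P Q g h x - deriv_op P g h h x)"

definition christoffel_form ::
  "('m::t2_space, 'n::finite) chart set \<Rightarrow>
   (('m, 'n) tensor2 \<Rightarrow> ('m, 'n) tensor2 \<Rightarrow> ('m, 'n) tensor2) \<Rightarrow>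
   (('m, 'n) tensor2 \<Rightarrow> ('m, 'n) tensor2 \<Rightarrow> ('m, 'n) tensor2 \<Rightarrow> ('m, 'n) tensor2) \<Rightarrow>
   ('m, 'n) tensor2 \<Rightarrow> ('m, 'n) tensor2 \<Rightarrow> ('m, 'n) tensor2 \<Rightarrow> ('m, 'n) tensor2" where
  "christoffel_form A P Q g h k = (\<lambda>x. (1/2) *\<^sub>R
     (geodesic_quadratic A P Q g (\<lambda>z. h z + k z) x
      - geodesic_quadratic A P Q g h x - geodesic_quadratic A P Q g k x))"

text \<open>\<open>ray g\<^sub>0\<close> is \<open>\<N>\<close>; \<open>line g\<^sub>0\<close> is its tangent space, the same at every point of \<open>\<N>\<close>.\<close>

definition ray :: "('m, 'n::finite) tensor2 \<Rightarrow> ('m, 'n) tensor2 set" where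
  "ray g0 = {g. \<exists>r::real. r > 0 \<and> g = (\<lambda>x. r *\<^sub>R g0 x)}"

definition line :: "('m, 'n::finite) tensor2 \<Rightarrow> ('m, 'n) tensor2 set" where
  "line g0 = {h. \<exists>a::real. h = (\<lambda>x. a *\<^sub>R g0 x)}"

definition totally_geodesic ::
  "('m::t2_space, 'n::finite) chart set \<Rightarrow>
   (('m, 'n) tensor2 \<Rightarrow> ('m, 'n) tensor2 \<Rightarrow> ('m, 'n) tensor2) \<Rightarrow>
   (('m, 'n) tensor2 \<Rightarrow> ('m, 'n) tensor2 \<Rightarrow> ('m, 'n) tensor2 \<Rightarrow> ('m, 'n) tensor2) \<Rightarrow>
   ('m, 'n) tensor2 set \<Rightarrow> (('m, 'n) tensor2 \<Rightarrow> ('m, 'n) tensor2 set) \<Rightarrow> bool" where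
  "totally_geodesic A P Q N T \<longleftrightarrow>
     (\<forall>g\<in>N. \<forall>h\<in>T g. \<forall>k\<in>T g. christoffel_form A P Q g h k \<in> T g)"

definition L2_normal ::
  "('m::t2_space, 'n::finite) chart set \<Rightarrow> ('m, 'n) tensor2 \<Rightarrow> ('m, 'n) tensor2 set \<Rightarrow> ('m, 'n) tensor2 \<Rightarrow> bool" where
  "L2_normal A g T m \<longleftrightarrow> (\<forall>k\<in>T. L2_inner A g m k = 0)"


section \<open>Levi-Civita derivative and the conserved quantity\<close>

definition pderiv_comp :: "(real^'n::finite \<Rightarrow> real^'n^'n) \<Rightarrow> real^'n \<Rightarrow> 'n \<Rightarrow> 'n \<Rightarrow> 'n \<Rightarrow> real" where
  "pderiv_comp B y k i j = frechet_derivative (\<lambda>z. B z $ i $ j) (at y) (axis k 1)"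

text \<open>\<open>levi_civita G y l k i\<close> is \<open>\<Gamma>\<^sup>l\<^sub>k\<^sub>i\<close> and \<open>nabla G B y k i j\<close> is \<open>(\<nabla>\<^sub>k B)\<^sub>i\<^sub>j\<close> for components \<open>G\<close>, \<open>B\<close> of a metric and
  a (0,2)-tensor field in one chart.\<close>

definition levi_civita :: "(real^'n::finite \<Rightarrow> real^'n^'n) \<Rightarrow> real^'n \<Rightarrow> 'n \<Rightarrow> 'n \<Rightarrow> 'n \<Rightarrow> real" where
  "levi_civita G y l k i = (\<Sum>m\<in>UNIV. 1/2 * matrix_inv (G y) $ l $ m *
     (pderiv_comp G y k m i + pderiv_comp G y i m k - pderiv_comp G y m k i))"

definition nabla ::
  "(real^'n::finite \<Rightarrow> real^'n^'n) \<Rightarrow> (real^'n \<Rightarrow> real^'n^'n) \<Rightarrow> real^'n \<Rightarrow> 'n \<Rightarrow> 'n \<Rightarrow> 'n \<Rightarrow> real" where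
  "nabla G B y k i j = pderiv_comp B y k i j
     - (\<Sum>l\<in>UNIV. levi_civita G y l k i * B y $ l $ j)
     - (\<Sum>l\<in>UNIV. levi_civita G y l k j * B y $ i $ l)"

text \<open>The component with index \<open>j\<close>, in the chart \<open>c\<close>, of the one-form valued density \<open>(\<nabla>\<^sup>*B) vol(g)\<close>.\<close>

definition nabla_star_vol ::
  "('m::t2_space, 'n::finite) chart set \<Rightarrow> ('m, 'n) chart \<Rightarrow> ('m, 'n) tensor2 \<Rightarrow> ('m, 'n) tensor2 \<Rightarrow>
   real^'n \<Rightarrow> 'n \<Rightarrow> real" where
  "nabla_star_vol A c g B y j =
     - (\<Sum>k\<in>UNIV. \<Sum>i\<in>UNIV. matrix_inv (components A c g y) $ k $ i *
           nabla (components A c g) (components A c B) y k i j)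
     * sqrt (det (components A c g y))"

end

theory Submission
  imports Defs
begin

text \<open>Everything takes place on the ray \<open>r g\<^sub>0\<close>, where the operator and the metric only enter through
  scalars. Write \<open>P\<^bsub>rg\<^sub>0\<^esub> g\<^sub>0 = \<Psi>(r) g\<^sub>0\<close>; positivity of \<open>P\<close> gives \<open>\<Psi>(r) \<parallel>g\<^sub>0\<parallel>\<^sup>2 > 0\<close>, so \<open>\<Psi>\<close> has no zero and
  \<open>P\<^bsub>rg\<^sub>0\<^esub>\<close>, being injective, takes values in \<open>\<real> g\<^sub>0\<close> exactly on \<open>\<real> g\<^sub>0\<close>. Smoothness of \<open>P\<close> along the curve
  \<open>t \<mapsto> e\<^sup>t g\<^sub>0\<close>, which stays in the space of metrics for all times, makes \<open>\<Psi>\<close> differentiable. All terms of the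
  geodesic equation except the adjoint one are then multiples of \<open>g\<^sub>0\<close>.

  (a) \<open>\<longleftrightarrow>\<close> (b): solving for the acceleration at velocity \<open>a g\<^sub>0\<close> means applying the inverse of \<open>P\<close> to
  \<open>a\<^sup>2 (1/2 (D P g\<^sub>0)\<^sup>*(g\<^sub>0) + multiple of g\<^sub>0)\<close>. Hence \<open>\<Gamma>(a g\<^sub>0, b g\<^sub>0)\<close> is \<open>a b\<close> times one fixed field, and that field lies
  in \<open>\<real> g\<^sub>0\<close> if and only if \<open>(D P g\<^sub>0)\<^sup>*(g\<^sub>0)\<close> does (\<open>totally_geodesic_iff_adjoint_g0\<close>); by bilinearity this
  is (b).

  (b) \<open>\<longleftrightarrow>\<close> (c): the defining property of the adjoint turns (c) into the statement that \<open>(D P h)\<^sup>*(k)\<close> is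
  L2-orthogonal to every \<open>m\<close> normal to \<open>g\<^sub>0\<close>. What is to be shown is that a field with this property is a
  multiple of \<open>g\<^sub>0\<close> (\<open>L2_double_normal_line\<close>). Its component \<open>m\<close> normal to \<open>g\<^sub>0\<close> is L2-orthogonal to all smooth
  fields, in particular to \<open>n = P\<^sup>-\<^sup>1 m\<close>; since \<open>\<langle>P n, n\<rangle> = 0\<close> forces \<open>n = 0\<close>, it vanishes. The positivity of \<open>P\<close> thus
  replaces an argument on the definiteness of the L2 product. Splitting off a component needs the additivity
  of the L2 product, that is, integrability of its integrand over the cells: in a chart it is a continuous
  function of the components, and the cells are relatively compact in chart domains.

  The equation for \<open>r\<close> is the geodesic equation for \<open>P g\<^sub>t = r' \<Psi>(r) g\<^sub>0\<close>, divided by the nowhere vanishing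
  field \<open>g\<^sub>0\<close>. Finally \<open>P g\<^sub>t\<close> is a constant multiple of the metric at each time, so it is parallel and the
  conserved quantity vanishes.\<close>

section \<open>Smooth functions on open sets\<close>

lemma frechet_derivative_cong_open:
  assumes "open S" "x \<in> S" "\<And>y. y \<in> S \<Longrightarrow> f y = g y"
  shows "frechet_derivative f (at x) = frechet_derivative g (at x)"
proof -
  have "(f has_derivative D) (at x) \<longleftrightarrow> (g has_derivative D) (at x)" for D
    using has_derivative_transform_within_open[OF _ assms(1,2)] assms(3) by metis
  then show ?thesis unfolding frechet_derivative_def by simp
qed

lemma differentiable_cong_open:
  assumes "open S" "x \<in> S" "\<And>y. y \<in> S \<Longrightarrow> f y = g y" "f differentiable (at x)"
  shows "g differentiable (at x)"
  using assms has_derivative_transform_within_open unfolding differentiable_def by metis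

text \<open>Smoothness quantifies over lists of directions, and the derivatives of a product in such a list are a
  growing sum of products. Counting the order of differentiability instead allows an induction in
  which the two summands of the product rule are treated by the induction hypothesis. All derivatives of order at most
  \<open>n\<close> are themselves differentiable, so that \<open>n = 0\<close> is plain differentiability.\<close>

primrec differentiable_upto ::
  "nat \<Rightarrow> 'a::real_normed_vector set \<Rightarrow> ('a \<Rightarrow> 'b::real_normed_vector) \<Rightarrow> bool" where
  "differentiable_upto 0 S f \<longleftrightarrow> (\<forall>x\<in>S. f differentiable (at x))"
| "differentiable_upto (Suc n) S f \<longleftrightarrow> (\<forall>x\<in>S. f differentiable (at x)) \<and>
     (\<forall>v. differentiable_upto n S (\<lambda>x. frechet_derivative f (at x) v))"

lemma differentiable_upto_iff_dderivs:
  "differentiable_upto n S f \<longleftrightarrow>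
     (\<forall>vs. length vs \<le> n \<longrightarrow> (\<forall>x\<in>S. dderivs vs f differentiable (at x)))"
proof (induction n arbitrary: f)
  case 0
  then show ?case by simp
next
  case (Suc n)
  have all_lists: "(\<forall>vs. length vs \<le> Suc n \<longrightarrow> R vs) \<longleftrightarrow>
      R [] \<and> (\<forall>v vs. length vs \<le> n \<longrightarrow> R (v # vs))" for R :: "'a list \<Rightarrow> bool"
  proof
    assume r: "R [] \<and> (\<forall>v vs. length vs \<le> n \<longrightarrow> R (v # vs))"
    show "\<forall>vs. length vs \<le> Suc n \<longrightarrow> R vs"
    proof (intro allI impI)
      fix vs :: "'a list" assume "length vs \<le> Suc n"
      then show "R vs" using r by (cases vs) auto
    qed
  qed auto
  show ?case unfolding all_lists by (simp add: Suc)
qed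

lemma smooth_on_iff_differentiable_upto: "smooth_on S f \<longleftrightarrow> (\<forall>n. differentiable_upto n S f)"
  unfolding smooth_on_def differentiable_upto_iff_dderivs by blast

lemma smooth_on_differentiable: "smooth_on S f \<Longrightarrow> x \<in> S \<Longrightarrow> f differentiable (at x)"
  by (metis differentiable_upto.simps(1) smooth_on_iff_differentiable_upto)

lemma smooth_on_directional_derivative:
  "smooth_on S f \<Longrightarrow> smooth_on S (\<lambda>x. frechet_derivative f (at x) v)"
  by (metis differentiable_upto.simps(2) smooth_on_iff_differentiable_upto)

lemma differentiable_upto_cong:
  assumes "open S" "\<And>x. x \<in> S \<Longrightarrow> f x = g x" "differentiable_upto n S f"
  shows "differentiable_upto n S g"
  using assms(2,3)
proof (induction n arbitrary: f g)
  case 0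
  then show ?case using differentiable_cong_open[OF assms(1)] by (metis differentiable_upto.simps(1))
next
  case (Suc n)
  have "frechet_derivative f (at x) = frechet_derivative g (at x)" if "x \<in> S" for x
    using frechet_derivative_cong_open[OF assms(1) that] Suc.prems(1) by blast
  then have "differentiable_upto n S (\<lambda>x. frechet_derivative g (at x) v)" for v
    using Suc.IH[of "\<lambda>x. frechet_derivative f (at x) v" "\<lambda>x. frechet_derivative g (at x) v"] Suc.prems(2)
    by simp
  then show ?case using differentiable_cong_open[OF assms(1)] Suc.prems
    by (metis differentiable_upto.simps(2))
qed

lemma differentiable_upto_add:
  assumes "open S" "differentiable_upto n S f" "differentiable_upto n S g"
  shows "differentiable_upto n S (\<lambda>x. f x + g x)"
  using assms(2,3)
proof (induction n arbitrary: f g)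
  case 0
  then show ?case by simp
next
  case (Suc n)
  have "frechet_derivative f (at x) v + frechet_derivative g (at x) v
      = frechet_derivative (\<lambda>x. f x + g x) (at x) v" if "x \<in> S" for x v
  proof -
    have "((\<lambda>x. f x + g x) has_derivative
        (\<lambda>v. frechet_derivative f (at x) v + frechet_derivative g (at x) v)) (at x)"
      using Suc.prems that
      by (intro has_derivative_add iffD1[OF frechet_derivative_works]) simp_all
    from frechet_derivative_at[OF this] show ?thesis by metis
  qed
  then have "differentiable_upto n S (\<lambda>x. frechet_derivative (\<lambda>x. f x + g x) (at x) v)" for v
    using differentiable_upto_cong[OF assms(1), of
        "\<lambda>x. frechet_derivative f (at x) v + frechet_derivative g (at x) v"] Suc.IH Suc.prems
    by simp
  then show ?case using Suc.prems by simp
qed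

lemma smooth_on_add:
  "open S \<Longrightarrow> smooth_on S f \<Longrightarrow> smooth_on S g \<Longrightarrow> smooth_on S (\<lambda>x. f x + g x)"
  by (simp add: smooth_on_iff_differentiable_upto differentiable_upto_add)

lemma has_derivative_scaleR_product:
  fixes a :: "'c::real_normed_vector \<Rightarrow> real" and F :: "'a::real_normed_vector \<Rightarrow> 'b::real_normed_vector"
  assumes "a differentiable (at (fst z))" "F differentiable (at (snd z))"
  shows "((\<lambda>z. a (fst z) *\<^sub>R F (snd z)) has_derivative
    (\<lambda>v. a (fst z) *\<^sub>R frechet_derivative F (at (snd z)) (snd v)
      + frechet_derivative a (at (fst z)) (fst v) *\<^sub>R F (snd z))) (at z)"
  using has_derivative_compose[OF has_derivative_fst[OF has_derivative_ident]
      assms(1)[unfolded frechet_derivative_works]]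
    has_derivative_compose[OF has_derivative_snd[OF has_derivative_ident]
      assms(2)[unfolded frechet_derivative_works]]
  by (rule has_derivative_scaleR)

text \<open>The factors depend on separate variables, so that a directional derivative is a sum of two terms of
  the same form, with smooth factors again. This is the joint smoothness of a curve \<open>t \<mapsto> a(t) h\<close> of tensor
  fields.\<close>

lemma differentiable_upto_scaleR_product:
  fixes a :: "'c::real_normed_vector \<Rightarrow> real" and F :: "'a::real_normed_vector \<Rightarrow> 'b::real_normed_vector"
  assumes "open I" "open U" "smooth_on I a" "smooth_on U F"
  shows "differentiable_upto n (I \<times> U) (\<lambda>z. a (fst z) *\<^sub>R F (snd z))"
  using assms(3,4)
proof (induction n arbitrary: a F)
  case (0 a F)
  have "(\<lambda>z. a (fst z) *\<^sub>R F (snd z)) differentiable (at z)" if "z \<in> I \<times> U" for z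
    using has_derivative_scaleR_product[of a z F] that smooth_on_differentiable[OF 0(1)]
      smooth_on_differentiable[OF 0(2)]
    unfolding differentiable_def[of "\<lambda>z. a (fst z) *\<^sub>R F (snd z)"] mem_Times_iff by blast
  then show ?case by simp
next
  case (Suc n a F)
  let ?f = "\<lambda>z. a (fst z) *\<^sub>R F (snd z)"
  have der: "(?f has_derivative (\<lambda>v. a (fst z) *\<^sub>R frechet_derivative F (at (snd z)) (snd v)
      + frechet_derivative a (at (fst z)) (fst v) *\<^sub>R F (snd z))) (at z)" if "z \<in> I \<times> U" for z
    using that smooth_on_differentiable[OF Suc.prems(1)] smooth_on_differentiable[OF Suc.prems(2)]
    by (intro has_derivative_scaleR_product) auto
  have "differentiable_upto n (I \<times> U) (\<lambda>z. frechet_derivative ?f (at z) v)" for v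
  proof (rule differentiable_upto_cong)
    show "open (I \<times> U)" using assms(1,2) by (rule open_Times)
    show "a (fst z) *\<^sub>R frechet_derivative F (at (snd z)) (snd v)
        + frechet_derivative a (at (fst z)) (fst v) *\<^sub>R F (snd z) = frechet_derivative ?f (at z) v"
      if "z \<in> I \<times> U" for z
      by (rule fun_cong[OF frechet_derivative_at[OF der[OF that]]])
    show "differentiable_upto n (I \<times> U) (\<lambda>z. a (fst z) *\<^sub>R frechet_derivative F (at (snd z)) (snd v)
        + frechet_derivative a (at (fst z)) (fst v) *\<^sub>R F (snd z))"
      by (intro differentiable_upto_add open_Times assms(1,2) Suc.IH
          Suc.prems smooth_on_directional_derivative)
  qed
  then show ?case using der unfolding differentiable_upto.simps(2) differentiable_def by blast
qed

lemma smooth_on_const: "smooth_on S (\<lambda>_. c)"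
proof -
  have "\<forall>x. dderivs vs (\<lambda>_. c) differentiable (at x)" for vs
    by (induction vs arbitrary: c) simp_all
  then show ?thesis unfolding smooth_on_def by blast
qed

lemma smooth_on_scaleR_const:
  assumes "open S" "smooth_on S f"
  shows "smooth_on S (\<lambda>x. a *\<^sub>R f x)"
  unfolding smooth_on_iff_differentiable_upto
proof
  show "differentiable_upto n S (\<lambda>x. a *\<^sub>R f x)" for n
    using assms(2)
  proof (induction n arbitrary: f)
    case 0
    then show ?case by (simp add: smooth_on_differentiable)
  next
    case (Suc n)
    have der: "((\<lambda>x. a *\<^sub>R f x) has_derivative (\<lambda>v. a *\<^sub>R frechet_derivative f (at x) v)) (at x)"
      if "x \<in> S" for x
      by (intro has_derivative_scaleR_right iffD1[OF frechet_derivative_works]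
          smooth_on_differentiable[OF Suc.prems that])
    have "differentiable_upto n S (\<lambda>x. frechet_derivative (\<lambda>x. a *\<^sub>R f x) (at x) v)" for v
    proof (rule differentiable_upto_cong[OF assms(1)])
      show "a *\<^sub>R frechet_derivative f (at x) v = frechet_derivative (\<lambda>x. a *\<^sub>R f x) (at x) v"
        if "x \<in> S" for x using frechet_derivative_at[OF der[OF that]] by metis
      show "differentiable_upto n S (\<lambda>x. a *\<^sub>R frechet_derivative f (at x) v)"
        by (rule Suc.IH[OF smooth_on_directional_derivative[OF Suc.prems]])
    qed
    then show ?case using der unfolding differentiable_upto.simps(2) differentiable_def by blast
  qed
qed

lemma smooth_on_exp: "smooth_on S (exp :: real \<Rightarrow> real)"
proof -
  have der: "((\<lambda>x::real. c * exp x) has_derivative (\<lambda>v. (c * v) * exp x)) (at x)" for c x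
    by (auto intro!: derivative_eq_intros)
  have "\<exists>d. dderivs vs (\<lambda>x::real. c * exp x) = (\<lambda>x. d * exp x)" for vs c
  proof (induction vs arbitrary: c)
    case (Cons v vs)
    have "frechet_derivative (\<lambda>x::real. c * exp x) (at x) v = (c * v) * exp x" for x
      using frechet_derivative_at[OF der] by metis
    then show ?case using Cons by simp
  qed auto
  from this[of _ 1] have "\<exists>d. dderivs vs (exp :: real \<Rightarrow> real) = (\<lambda>x. d * exp x)" for vs
    by simp
  moreover have "(\<lambda>x::real. d * exp x) differentiable (at x)" for d x
    using der unfolding differentiable_def by blast
  ultimately show ?thesis unfolding smooth_on_def by metis
qed


section \<open>Inverse matrices and traces\<close>

lemma matrix_add_rdistrib:
  fixes X Y :: "real^'m^'n" and Z :: "real^'k^'m"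
  shows "(X + Y) ** Z = X ** Z + Y ** Z"
  by (simp add: vec_eq_iff matrix_matrix_mult_def distrib_right sum.distrib)

lemma invertible_nonzero:
  fixes M :: "real^'n^'n"
  assumes "invertible M"
  shows "M \<noteq> 0"
proof -
  have "mat 0 = (0 :: real^'n^'n)" by (simp add: mat_def vec_eq_iff)
  then have "det (0 :: real^'n^'n) = 0" using det_0 by metis
  then show ?thesis using assms invertible_det_nz by blast
qed

lemma matrix_inv_unique:
  fixes A B :: "real^'n^'n"
  assumes "A ** B = mat 1"
  shows "matrix_inv A = B"
proof -
  have BA: "B ** A = mat 1" using assms by (simp add: matrix_left_right_inverse)
  have "A ** matrix_inv A = mat 1 \<and> matrix_inv A ** A = mat 1"
    unfolding matrix_inv_def by (rule someI[of _ B]) (use assms BA in blast)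
  then have "B ** (A ** matrix_inv A) = B" by simp
  then show ?thesis unfolding matrix_mul_assoc BA by simp
qed

lemma
  fixes A :: "real^'n^'n"
  assumes "invertible A"
  shows matrix_inv_right: "A ** matrix_inv A = mat 1"
    and matrix_inv_left: "matrix_inv A ** A = mat 1"
  using assms matrix_inv_unique unfolding invertible_def by metis+

lemma matrix_inv_scaleR:
  fixes A :: "real^'n^'n"
  assumes "invertible A" "c \<noteq> 0"
  shows "matrix_inv (c *\<^sub>R A) = (1 / c) *\<^sub>R matrix_inv A"
  by (rule matrix_inv_unique)
    (use assms in \<open>simp add: matrix_scalar_ac scalar_matrix_assoc[symmetric] matrix_inv_right\<close>)

lemma trace_scaleR: "trace (c *\<^sub>R (A :: real^'n^'n)) = c * trace A"
  by (simp add: trace_def sum_distrib_left)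

lemma matrix_inv_congruence:
  fixes G J :: "real^'n^'n"
  assumes "invertible G" "invertible J"
  shows "matrix_inv (transpose J ** G ** J)
       = matrix_inv J ** matrix_inv G ** transpose (matrix_inv J)"
proof (rule matrix_inv_unique)
  have tr: "transpose J ** transpose (matrix_inv J) = mat 1"
    by (simp add: matrix_transpose_mul[symmetric] matrix_inv_left[OF assms(2)])
  have "transpose J ** G ** J ** (matrix_inv J ** matrix_inv G ** transpose (matrix_inv J))
    = transpose J ** (G ** ((J ** matrix_inv J) ** matrix_inv G)) ** transpose (matrix_inv J)"
    by (simp only: matrix_mul_assoc)
  also have "\<dots> = mat 1" by (simp add: matrix_inv_right assms tr)
  finally show "transpose J ** G ** J ** (matrix_inv J ** matrix_inv G ** transpose (matrix_inv J)) = mat 1" .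
qed

text \<open>Under a change of basis the mixed tensor \<open>G\<^sup>-\<^sup>1 X\<close> is conjugated by \<open>J\<close>, and the trace does not see a
  conjugation. With \<open>J\<close> a Jacobian matrix this says that \<open>g\<^sup>0\<^sub>2(h, k)\<close> can be computed in any chart.\<close>

lemma trace_contraction_congruence:
  fixes G H K J :: "real^'n^'n"
  assumes "invertible G" "invertible J"
  shows "trace (matrix_inv (transpose J ** G ** J) ** (transpose J ** H ** J)
            ** matrix_inv (transpose J ** G ** J) ** (transpose J ** K ** J))
       = trace (matrix_inv G ** H ** matrix_inv G ** K)"
proof -
  have tr: "transpose (matrix_inv J) ** transpose J = mat 1"
    by (simp add: matrix_transpose_mul[symmetric] matrix_inv_right[OF assms(2)])
  have raise: "matrix_inv (transpose J ** G ** J) ** (transpose J ** X ** J)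
      = matrix_inv J ** (matrix_inv G ** X) ** J" for X
  proof -
    have "matrix_inv (transpose J ** G ** J) ** (transpose J ** X ** J)
      = matrix_inv J ** matrix_inv G ** ((transpose (matrix_inv J) ** transpose J) ** X) ** J"
      unfolding matrix_inv_congruence[OF assms] by (simp only: matrix_mul_assoc)
    then show ?thesis by (simp add: tr matrix_mul_assoc)
  qed
  have "matrix_inv (transpose J ** G ** J) ** (transpose J ** H ** J)
            ** matrix_inv (transpose J ** G ** J) ** (transpose J ** K ** J)
      = matrix_inv (transpose J ** G ** J) ** (transpose J ** H ** J)
            ** (matrix_inv (transpose J ** G ** J) ** (transpose J ** K ** J))"
    by (simp only: matrix_mul_assoc)
  also have "\<dots> = matrix_inv J ** (matrix_inv G ** H) ** ((J ** matrix_inv J) ** ((matrix_inv G ** K) ** J))"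
    unfolding raise by (simp only: matrix_mul_assoc)
  also have "\<dots> = matrix_inv J ** ((matrix_inv G ** H ** matrix_inv G ** K) ** J)"
    by (simp add: matrix_inv_right[OF assms(2)] matrix_mul_assoc)
  finally show ?thesis
    using trace_mul_sym[of "matrix_inv J" "(matrix_inv G ** H ** matrix_inv G ** K) ** J"]
    by (simp add: matrix_mul_assoc[symmetric] matrix_inv_right[OF assms(2)])
qed

lemma continuous_on_det:
  fixes F :: "'a::topological_space \<Rightarrow> real^'n^'n"
  assumes "continuous_on S F"
  shows "continuous_on S (\<lambda>x. det (F x))"
  unfolding det_def by (intro continuous_intros assms)

lemma continuous_on_matrix_mult:
  fixes F :: "'a::topological_space \<Rightarrow> real^'m^'n" and G :: "'a \<Rightarrow> real^'k^'m"
  assumes "continuous_on S F" "continuous_on S G"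
  shows "continuous_on S (\<lambda>x. F x ** G x)"
  unfolding matrix_matrix_mult_def by (intro continuous_intros assms)

lemma continuous_on_trace:
  fixes F :: "'a::topological_space \<Rightarrow> real^'n^'n"
  assumes "continuous_on S F"
  shows "continuous_on S (\<lambda>x. trace (F x))"
  unfolding trace_def by (intro continuous_intros assms)

text \<open>By Cramer's rule the entries of the inverse are quotients of determinants.\<close>

lemma continuous_on_matrix_inv:
  fixes F :: "'a::topological_space \<Rightarrow> real^'n^'n"
  assumes F: "continuous_on S F" and inv: "\<And>x. x \<in> S \<Longrightarrow> invertible (F x)"
  shows "continuous_on S (\<lambda>x. matrix_inv (F x))"
proof -
  define D where "D k l M = det (\<chi> i j. if j = k then axis l 1 $ i else (M :: real^'n^'n) $ i $ j)"
    for k l M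
  have entry: "matrix_inv (F x) $ k $ l = D k l (F x) / det (F x)" if "x \<in> S" for x k l
  proof -
    have "F x *v (matrix_inv (F x) *v axis l 1) = axis l 1"
      by (simp add: matrix_vector_mul_assoc matrix_inv_right[OF inv[OF that]])
    then have "matrix_inv (F x) *v axis l 1 = (\<chi> k. D k l (F x) / det (F x))"
      using cramer[of "F x"] inv[OF that] unfolding D_def invertible_det_nz by blast
    then have "(matrix_inv (F x) *v axis l 1) $ k = D k l (F x) / det (F x)" by simp
    then show ?thesis by (simp add: matrix_vector_mul_component inner_axis row_def)
  qed
  have "continuous_on S (\<lambda>x. D k l (F x))" for k l
  proof -
    have "continuous_on S (\<lambda>x. if j = k then axis l 1 $ i else F x $ i $ j)" for i j
      by (cases "j = k") (auto intro!: continuous_intros F)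
    then show ?thesis unfolding D_def by (intro continuous_on_det continuous_on_vec_lambda)
  qed
  moreover have "\<forall>x\<in>S. det (F x) \<noteq> 0" using inv invertible_det_nz by blast
  ultimately have "continuous_on S (\<lambda>x. \<chi> k l. D k l (F x) / det (F x))"
    by (intro continuous_on_vec_lambda continuous_on_divide continuous_on_det F)
  moreover have "matrix_inv (F x) = (\<chi> k l. D k l (F x) / det (F x))" if "x \<in> S" for x
    using entry[OF that] by (simp add: vec_eq_iff)
  ultimately show ?thesis by (simp cong: continuous_on_cong)
qed

lemma positive_definite_invertible:
  fixes G :: "real^'n^'n"
  assumes "\<And>v. v \<noteq> 0 \<Longrightarrow> v \<bullet> (G *v v) > 0"
  shows "invertible G"
  unfolding invertible_left_inverse matrix_left_invertible_ker
  using assms by (metis inner_zero_right less_irrefl)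


section \<open>Tensor fields in charts and their L2 product\<close>

lemma components_scaleR: "components A c (\<lambda>x. a *\<^sub>R h x) = (\<lambda>y. a *\<^sub>R components A c h y)"
  by (simp add: fun_eq_iff components_def matrix_scalar_ac scalar_matrix_assoc[symmetric])

lemma components_add:
  "components A c (\<lambda>x. h x + k x) = (\<lambda>y. components A c h y + components A c k y)"
  by (simp add: fun_eq_iff components_def matrix_add_ldistrib matrix_add_rdistrib)

lemma components_symmetric:
  "h \<in> sym_fields A \<Longrightarrow> transpose (components A c h y) = components A c h y"
  by (simp add: components_def sym_fields_def matrix_transpose_mul matrix_mul_assoc)

lemma metric_sym_field: "g \<in> metrics A \<Longrightarrow> g \<in> sym_fields A"
  by (simp add: metrics_def)

lemma metric_invertible: "g \<in> metrics A \<Longrightarrow> invertible (g x)"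
  by (auto simp: metrics_def intro: positive_definite_invertible)

lemma metric_nonzero: "g \<in> metrics A \<Longrightarrow> g x \<noteq> 0"
  by (rule invertible_nonzero[OF metric_invertible[of g A x]])

context
  fixes A :: "('m::t2_space, 'n::finite) chart set"
  assumes A: "smooth_structure A"
begin

lemma chart_facts:
  assumes "c \<in> A"
  shows "open (cdom c)" "open (cimage c)" "homeomorphism (cdom c) (cimage c) (cmap c) (cinv c)"
  using A assms unfolding smooth_structure_def is_chart_def by blast+

lemma cinv_cmap: "c \<in> A \<Longrightarrow> x \<in> cdom c \<Longrightarrow> cinv c (cmap c x) = x"
  using chart_facts(3) by (simp add: homeomorphism_def)

lemma point_in_chart: obtains c where "c \<in> A" "x \<in> cdom c"
  using A unfolding smooth_structure_def by blast

text \<open>The two changes of coordinates between the chart and the reference chart are inverse to each other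
  near the point; differentiate the composition.\<close>

lemma invertible_jacobian_at:
  assumes c: "c \<in> A" and y: "y \<in> cimage c"
  shows "invertible (jacobian_at A c y)"
proof -
  obtain x where x: "x \<in> cdom c" "y = cmap c x" using y by blast
  define e where "e = chart_at A x"
  have "e \<in> A \<and> x \<in> cdom e"
    unfolding e_def chart_at_def by (rule someI[of _ c]) (use c x in blast)
  then have e: "e \<in> A" "x \<in> cdom e" by auto
  let ?H = "cmap e \<circ> cinv c" and ?K = "cmap c \<circ> cinv e" and ?S = "cmap c ` (cdom c \<inter> cdom e)"
  have "smooth_on ?S ?H" "smooth_on (cmap e ` (cdom c \<inter> cdom e)) ?K"
    using A c e(1) unfolding smooth_structure_def compatible_def by blast+
  then have "?H differentiable (at (cmap c x))" "?K differentiable (at (cmap e x))"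
    using x e by (auto intro!: smooth_on_differentiable)
  moreover have "?H (cmap c x) = cmap e x" using cinv_cmap[OF c x(1)] by simp
  ultimately obtain H' K' where
    H: "(?H has_derivative H') (at (cmap c x))" "H' = frechet_derivative ?H (at (cmap c x))"
    and K: "(?K has_derivative K') (at (?H (cmap c x)))"
    unfolding frechet_derivative_works by metis
  have "openin (top_of_set (cdom c)) (cdom c \<inter> cdom e)"
    using chart_facts(1)[OF e(1)] by (simp add: openin_open_Int)
  then have "openin (top_of_set (cimage c)) ?S"
    using homeomorphism_imp_open_map[OF chart_facts(3)[OF c]] by blast
  then have opS: "open ?S" using chart_facts(2)[OF c] openin_open_eq by blast
  have "((\<lambda>z. z) has_derivative (K' \<circ> H')) (at (cmap c x))"
  proof (rule has_derivative_transform_within_open[OF diff_chain_at[OF H(1) K] opS])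
    show "cmap c x \<in> ?S" using x e by blast
    show "(?K \<circ> ?H) z = z" if "z \<in> ?S" for z
      using that cinv_cmap c e by auto
  qed
  then have "K' \<circ> H' = id"
    using has_derivative_unique has_derivative_ident unfolding id_def by blast
  then have "matrix K' ** matrix H' = mat 1"
    using matrix_compose[OF has_derivative_linear[OF H(1)] has_derivative_linear[OF K]]
    by (simp add: matrix_id_mat_1)
  moreover have "jacobian_at A c y = matrix H'"
    unfolding jacobian_at_def x(2) cinv_cmap[OF c x(1)] e_def[symmetric] H(2) ..
  ultimately show ?thesis using invertible_left_inverse by metis
qed

lemma sym_fields_scaleR: "h \<in> sym_fields A \<Longrightarrow> (\<lambda>x. a *\<^sub>R h x) \<in> sym_fields A"
  unfolding sym_fields_def mem_Collect_eq components_scaleR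
  by (intro conjI allI ballI smooth_on_scaleR_const chart_facts(2)) (simp_all add: transpose_scalar)

lemma sym_fields_add:
  "h \<in> sym_fields A \<Longrightarrow> k \<in> sym_fields A \<Longrightarrow> (\<lambda>x. h x + k x) \<in> sym_fields A"
  unfolding sym_fields_def mem_Collect_eq components_add
  by (intro conjI allI ballI smooth_on_add chart_facts(2)) (simp_all add: transpose_def vec_eq_iff)

lemma metrics_scaleR:
  assumes "g \<in> metrics A" "r > 0" shows "(\<lambda>x. r *\<^sub>R g x) \<in> metrics A"
  using assms sym_fields_scaleR
  by (auto simp: metrics_def scaleR_matrix_vector_assoc[symmetric])

lemma components_metric_invertible:
  assumes "g \<in> metrics A" "c \<in> A" "y \<in> cimage c"
  shows "invertible (components A c g y)"
  unfolding components_def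
  by (intro invertible_mult transpose_invertible invertible_jacobian_at assms metric_invertible[OF assms(1)])

lemma smooth_curve_scaleR:
  assumes "open I" "smooth_on I a" "h \<in> sym_fields A"
  shows "smooth_curve A I (\<lambda>t x. a t *\<^sub>R h x)"
proof -
  have "smooth_on (I \<times> cimage c) (\<lambda>z. a (fst z) *\<^sub>R components A c h (snd z))" if "c \<in> A" for c
    unfolding smooth_on_iff_differentiable_upto
    using differentiable_upto_scaleR_product assms chart_facts(2) that unfolding sym_fields_def by blast
  then show ?thesis
    using sym_fields_scaleR[OF assms(3)]
    by (simp add: smooth_curve_def components_scaleR case_prod_unfold)
qed

lemma inner02_components:
  assumes "g \<in> metrics A" "c \<in> A" "y \<in> cimage c"
  shows "inner02 g h k (cinv c y) = trace (matrix_inv (components A c g y) ** components A c h y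
           ** matrix_inv (components A c g y) ** components A c k y)"
  unfolding inner02_def components_def
  by (rule trace_contraction_congruence[symmetric])
    (intro metric_invertible[OF assms(1)] invertible_jacobian_at assms)+

lemma continuous_on_components:
  "h \<in> sym_fields A \<Longrightarrow> c \<in> A \<Longrightarrow> continuous_on (cimage c) (components A c h)"
  by (auto simp: sym_fields_def intro!: continuous_at_imp_continuous_on
      differentiable_imp_continuous_within smooth_on_differentiable)

lemma chart_image_borel:
  assumes "c \<in> A" "K \<in> sets borel" "K \<subseteq> cdom c"
  shows "cmap c ` K \<in> sets borel"
proof -
  have "cinv c \<in> measurable (restrict_space borel (cimage c)) borel"
    using homeomorphism_cont2[OF chart_facts(3)[OF assms(1)]]
    by (rule borel_measurable_continuous_on_restrict)
  then have "cinv c -` K \<inter> cimage c \<in> sets (restrict_space borel (cimage c))"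
    using measurable_sets[OF _ assms(2)] by (metis space_restrict_space space_borel Int_UNIV_right)
  moreover have "cinv c -` K \<inter> cimage c = cmap c ` K"
    using assms(3) cinv_cmap[OF assms(1)] by auto
  ultimately show ?thesis
    using chart_facts(2)[OF assms(1)] by (simp add: sets_restrict_space_iff)
qed

text \<open>The pointwise frame used to represent tensors is not continuous, so continuity of the integrand is
  only visible after it has been rewritten in terms of components with respect to the chart.\<close>

lemma L2_integrand_integrable:
  assumes M: "compact (UNIV :: 'm set)" and g: "g \<in> metrics A"
    and h: "h \<in> sym_fields A" and k: "k \<in> sym_fields A" and cell: "(c, K) \<in> cells A"
  shows "set_integrable lborel (cmap c ` K)
           (\<lambda>y. sqrt (det (components A c g y)) * inner02 g h k (cinv c y))"
proof -
  obtain C where c: "c \<in> A" and K: "K \<in> sets borel" and C: "compact C" "K \<subseteq> C" "C \<subseteq> cdom c"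
    using is_cells_cells[OF M A] cell unfolding is_cells_def by (fastforce dest: bspec)
  let ?f = "\<lambda>y. sqrt (det (components A c g y)) * inner02 g h k (cinv c y)"
  have "continuous_on (cimage c) (\<lambda>y. sqrt (det (components A c g y)) *
      trace (matrix_inv (components A c g y) ** components A c h y
           ** matrix_inv (components A c g y) ** components A c k y))"
    by (intro continuous_on_mult continuous_on_real_sqrt continuous_on_det continuous_on_trace
        continuous_on_matrix_mult continuous_on_matrix_inv continuous_on_components
        components_metric_invertible c g h k metric_sym_field)
  then have "continuous_on (cimage c) ?f"
    by (rule continuous_on_eq) (simp add: inner02_components[OF g c])
  then have "continuous_on (cmap c ` C) ?f"
    by (rule continuous_on_subset) (use C(3) in blast)
  moreover have "compact (cmap c ` C)"
    using compact_continuous_image[OF continuous_on_subset[OF homeomorphism_cont1[OF chart_facts(3)[OF c]] C(3)] C(1)] .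
  ultimately have "set_integrable lborel (cmap c ` C) ?f"
    unfolding set_integrable_def by (intro borel_integrable_compact)
  then show ?thesis
    by (rule set_integrable_subset) (use chart_image_borel[OF c K] C in auto)
qed

lemma L2_inner_add_left:
  assumes "compact (UNIV :: 'm set)" "g \<in> metrics A"
    and "h \<in> sym_fields A" "h' \<in> sym_fields A" "k \<in> sym_fields A"
  shows "L2_inner A g (\<lambda>x. h x + h' x) k = L2_inner A g h k + L2_inner A g h' k"
proof -
  have "inner02 g (\<lambda>x. h x + h' x) k = (\<lambda>x. inner02 g h k x + inner02 g h' k x)"
    by (simp add: fun_eq_iff inner02_def matrix_add_ldistrib matrix_add_rdistrib trace_add)
  then show ?thesis
    unfolding L2_inner_def vol_integral_def sum.distrib[symmetric]
    using set_integral_add(2)[OF L2_integrand_integrable[OF assms(1-3,5)]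
        L2_integrand_integrable[OF assms(1,2,4,5)]]
    by (intro sum.cong refl) (simp add: distrib_left case_prod_unfold)
qed

end

lemma L2_inner_commute: "L2_inner A g h k = L2_inner A g k h"
proof -
  have "inner02 g h k = inner02 g k h"
  proof
    show "inner02 g h k x = inner02 g k h x" for x
      unfolding inner02_def
      using trace_mul_sym[of "matrix_inv (g x) ** h x" "matrix_inv (g x) ** k x"]
      by (simp add: matrix_mul_assoc)
  qed
  then show ?thesis by (simp add: L2_inner_def)
qed

lemma L2_inner_scaleR_left: "L2_inner A g (\<lambda>x. a *\<^sub>R h x) k = a * L2_inner A g h k"
proof -
  have "inner02 g (\<lambda>x. a *\<^sub>R h x) k = (\<lambda>x. a * inner02 g h k x)"
    by (simp add: fun_eq_iff inner02_def matrix_scalar_ac scalar_matrix_assoc[symmetric] trace_scaleR)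
  then have "L2_inner A g (\<lambda>x. a *\<^sub>R h x) k
      = (\<Sum>(c, K)\<in>cells A. set_lebesgue_integral lborel (cmap c ` K)
          (\<lambda>y. a * (sqrt (det (components A c g y)) * inner02 g h k (cinv c y))))"
    by (simp add: L2_inner_def vol_integral_def mult.left_commute)
  also have "\<dots> = a * L2_inner A g h k"
    unfolding set_integral_mult_right L2_inner_def vol_integral_def
    by (simp add: sum_distrib_left case_prod_unfold)
  finally show ?thesis .
qed

lemma L2_inner_scaleR_right: "L2_inner A g h (\<lambda>x. a *\<^sub>R k x) = a * L2_inner A g h k"
  by (metis L2_inner_commute L2_inner_scaleR_left)


section \<open>Metric compatibility of the Levi-Civita derivative\<close>

text \<open>Lowering an index that was raised before.\<close>

lemma sum_inverse_metric:
  fixes M :: "real^'n^'n"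
  assumes "invertible M"
  shows "(\<Sum>l\<in>UNIV. (\<Sum>m\<in>UNIV. matrix_inv M $ l $ m * s m) * M $ j $ l) = s j"
proof -
  have "M *v (matrix_inv M *v (\<chi> m. s m)) = (\<chi> m. s m)"
    by (simp add: matrix_vector_mul_assoc matrix_inv_right[OF assms])
  then have "(M *v (matrix_inv M *v (\<chi> m. s m))) $ j = s j" by simp
  then show ?thesis by (simp add: matrix_vector_mult_def mult.commute)
qed

lemma levi_civita_lowered:
  assumes "invertible (G y)"
  shows "(\<Sum>l\<in>UNIV. levi_civita G y l k i * G y $ j $ l)
       = 1/2 * (pderiv_comp G y k j i + pderiv_comp G y i j k - pderiv_comp G y j k i)"
  using sum_inverse_metric[OF assms, of "\<lambda>m. 1/2 *
      (pderiv_comp G y k m i + pderiv_comp G y i m k - pderiv_comp G y m k i)" j]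
  unfolding levi_civita_def by (simp only: mult.assoc mult.left_commute[of _ "1/2"])

text \<open>Lowering the upper index of the Christoffel symbols leaves first derivatives of the metric, and the
  two correction terms of \<open>\<nabla>\<^sub>k g\<^sub>i\<^sub>j\<close> add up to \<open>\<partial>\<^sub>k g\<^sub>i\<^sub>j\<close> by the symmetry of \<open>g\<close>.\<close>

lemma nabla_metric:
  assumes sym: "\<And>z. transpose (G z) = G z" and inv: "invertible (G y)"
  shows "nabla G G y k i j = 0"
proof -
  have G: "G z $ i $ j = G z $ j $ i" for z i j
    using arg_cong[OF sym[of z], of "\<lambda>M. M $ j $ i"] by (simp add: transpose_def)
  have "pderiv_comp G y k i j = pderiv_comp G y k j i" for k i j
    unfolding pderiv_comp_def by (subst G) (rule refl)
  moreover have "(\<Sum>l\<in>UNIV. levi_civita G y l k i * G y $ l $ j)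
      = (\<Sum>l\<in>UNIV. levi_civita G y l k i * G y $ j $ l)" by (simp add: G[of _ _ j])
  ultimately show ?thesis
    unfolding nabla_def by (simp add: levi_civita_lowered[of G, OF inv])
qed

lemma nabla_scaleR:
  assumes "B differentiable (at y)"
  shows "nabla G (\<lambda>z. s *\<^sub>R B z) y k i j = s * nabla G B y k i j"
proof -
  have "pderiv_comp (\<lambda>z. s *\<^sub>R B z) y k i j = s * pderiv_comp B y k i j" for k i j
  proof -
    have "(B has_derivative frechet_derivative B (at y)) (at y)"
      using assms frechet_derivative_works by blast
    then have d: "((\<lambda>z. B z $ i $ j) has_derivative (\<lambda>v. frechet_derivative B (at y) v $ i $ j)) (at y)"
      by (intro bounded_linear.has_derivative[OF bounded_linear_vec_nth])
    have "((\<lambda>z. (s *\<^sub>R B z) $ i $ j) has_derivative (\<lambda>v. s * frechet_derivative B (at y) v $ i $ j)) (at y)"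
      using has_derivative_mult_right[OF d, of s] by simp
    from fun_cong[OF frechet_derivative_at[OF this]] fun_cong[OF frechet_derivative_at[OF d]]
    show ?thesis unfolding pderiv_comp_def by simp
  qed
  then show ?thesis
    unfolding nabla_def by (simp add: right_diff_distrib sum_distrib_left mult.left_commute)
qed


section \<open>An operator field along a ray of metrics\<close>

lemma has_vector_derivative_scaleR_fixed:
  "(f has_field_derivative d) (at t) \<Longrightarrow> ((\<lambda>s. f s *\<^sub>R v) has_vector_derivative d *\<^sub>R v) (at t)"
  using has_vector_derivative_scaleR[OF _ has_vector_derivative_const] by fastforce

text \<open>The function \<open>\<Psi>\<close> is a parameter because the final statement concerns every function that
  satisfies \<open>P\<^bsub>rg\<^sub>0\<^esub> g\<^sub>0 = \<Psi>(r) g\<^sub>0\<close> for positive \<open>r\<close>; its values elsewhere are arbitrary.\<close>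

locale operator_on_ray =
  fixes A :: "('m::t2_space, 'n::finite) chart set"
    and P :: "('m, 'n) tensor2 \<Rightarrow> ('m, 'n) tensor2 \<Rightarrow> ('m, 'n) tensor2"
    and Q :: "('m, 'n) tensor2 \<Rightarrow> ('m, 'n) tensor2 \<Rightarrow> ('m, 'n) tensor2 \<Rightarrow> ('m, 'n) tensor2"
    and g0 :: "('m, 'n) tensor2" and \<Psi> :: "real \<Rightarrow> real"
  assumes compact_M: "compact (UNIV :: 'm set)"
    and smooth_M: "smooth_structure A"
    and P_linear: "g \<in> metrics A \<Longrightarrow> lin_on_fields A (P g)"
    and P_pos_sym: "g \<in> metrics A \<Longrightarrow> positive_symmetric_op A g (P g)"
    and P_bij: "g \<in> metrics A \<Longrightarrow> bij_betw (P g) (sym_fields A) (sym_fields A)"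
    and smooth_P: "smooth_operator_family A P"
    and smooth_Q: "smooth_bilinear_family A Q"
    and g0: "g0 \<in> metrics A"
    and P_ray_g0: "r > 0 \<Longrightarrow> P (\<lambda>x. r *\<^sub>R g0 x) g0 = (\<lambda>x. \<Psi> r *\<^sub>R g0 x)"
begin

abbreviation mult_g0 :: "real \<Rightarrow> ('m, 'n) tensor2" where
  "mult_g0 a \<equiv> (\<lambda>x. a *\<^sub>R g0 x)"

lemma g0_sym: "g0 \<in> sym_fields A"
  using g0 by (rule metric_sym_field)

lemma mult_g0_sym: "mult_g0 a \<in> sym_fields A"
  by (rule sym_fields_scaleR[OF smooth_M g0_sym])

lemma mult_g0_metric: "r > 0 \<Longrightarrow> mult_g0 r \<in> metrics A"
  by (rule metrics_scaleR[OF smooth_M g0])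

lemma g0_nonzero: "g0 x \<noteq> 0"
  by (rule metric_nonzero[OF g0])

lemma in_ray_iff: "(\<forall>g\<in>ray g0. R g) \<longleftrightarrow> (\<forall>r>0. R (mult_g0 r))"
  unfolding ray_def by blast

lemma in_line_iff: "(\<forall>h\<in>line g0. R h) \<longleftrightarrow> (\<forall>a. R (mult_g0 a))"
  unfolding line_def by blast

lemma P_scaleR: "g \<in> metrics A \<Longrightarrow> h \<in> sym_fields A \<Longrightarrow> P g (\<lambda>x. a *\<^sub>R h x) = (\<lambda>x. a *\<^sub>R P g h x)"
  using P_linear unfolding lin_on_fields_def by blast

lemma P_mult_g0: "r > 0 \<Longrightarrow> P (mult_g0 r) (mult_g0 a) = mult_g0 (a * \<Psi> r)"
  using P_scaleR[OF mult_g0_metric g0_sym] by (simp add: P_ray_g0)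

lemma Q_mult_g0:
  assumes "r > 0"
  shows "Q (mult_g0 r) (mult_g0 a) (mult_g0 b) = (\<lambda>x. (a * b) *\<^sub>R Q (mult_g0 r) g0 g0 x)"
proof -
  have "lin_on_fields A (Q (mult_g0 r) h)" "lin_on_fields A (\<lambda>h. Q (mult_g0 r) h k)"
    if "h \<in> sym_fields A" "k \<in> sym_fields A" for h k
    using smooth_Q mult_g0_metric[OF assms] that unfolding smooth_bilinear_family_def by blast+
  then have "Q (mult_g0 r) (mult_g0 a) (mult_g0 b) = (\<lambda>x. b *\<^sub>R Q (mult_g0 r) (mult_g0 a) g0 x)"
    and "Q (mult_g0 r) (mult_g0 a) g0 = (\<lambda>x. a *\<^sub>R Q (mult_g0 r) g0 g0 x)"
    using g0_sym mult_g0_sym unfolding lin_on_fields_def by blast+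
  then show ?thesis by (simp add: mult.commute)
qed

lemma Q_sym_field:
  assumes "g \<in> metrics A" "h \<in> sym_fields A" "k \<in> sym_fields A"
  shows "Q g h k \<in> sym_fields A"
  using smooth_Q assms unfolding smooth_bilinear_family_def lin_on_fields_def by blast

text \<open>This is the positivity of \<open>P\<close>, tested on \<open>g\<^sub>0\<close>: neither \<open>\<Psi>\<close> nor the norm of \<open>g\<^sub>0\<close> vanishes.\<close>

lemma \<Psi>_L2_g0_positive:
  assumes "r > 0"
  shows "\<Psi> r * L2_inner A (mult_g0 r) g0 g0 > 0"
proof -
  have "g0 \<noteq> (\<lambda>x. 0)" using g0_nonzero by metis
  then have "L2_inner A (mult_g0 r) (P (mult_g0 r) g0) g0 > 0"
    using P_pos_sym[OF mult_g0_metric[OF assms]] g0_sym unfolding positive_symmetric_op_def by blast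
  then show ?thesis by (simp add: P_ray_g0[OF assms] L2_inner_scaleR_left)
qed

lemma \<Psi>_nonzero: "r > 0 \<Longrightarrow> \<Psi> r \<noteq> 0"
  using \<Psi>_L2_g0_positive by fastforce

text \<open>A smooth family of operators is only required to be smooth along curves of metrics that are defined on all of
  \<open>\<real>\<close>; the exponential parametrisation provides such a curve in the ray. The scalar is then recovered from the
  components of \<open>\<Psi> g\<^sub>0\<close> at one point, where \<open>g\<^sub>0\<close> does not vanish, by taking the inner product with those of
  \<open>g\<^sub>0\<close>.\<close>

lemma \<Psi>_differentiable:
  assumes "r > 0"
  shows "\<Psi> differentiable (at r)"
proof -
  fix x0 :: 'm
  obtain c where c: "c \<in> A" "x0 \<in> cdom c" using point_in_chart[OF smooth_M] by blast
  define M where "M = components A c g0 (cmap c x0)"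
  have "smooth_curve A UNIV (\<lambda>t. mult_g0 (exp t))" "smooth_curve A UNIV (\<lambda>t::real. g0)"
    using smooth_curve_scaleR[OF smooth_M open_UNIV smooth_on_exp g0_sym]
      smooth_curve_scaleR[OF smooth_M open_UNIV smooth_on_const[of _ 1] g0_sym] by simp_all
  then have "smooth_curve A UNIV (\<lambda>t. P (mult_g0 (exp t)) g0)"
    using smooth_P mult_g0_metric unfolding smooth_operator_family_def by simp
  then have "smooth_on (UNIV \<times> cimage c) (\<lambda>(t, y). \<Psi> (exp t) *\<^sub>R components A c g0 y)"
    using c(1) unfolding smooth_curve_def by (simp add: P_ray_g0 components_scaleR)
  then have "(\<lambda>(t, y). \<Psi> (exp t) *\<^sub>R components A c g0 y) differentiable (at (ln r, cmap c x0))"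
    using c(2) by (intro smooth_on_differentiable) auto
  then obtain D where D: "((\<lambda>(t, y). \<Psi> (exp t) *\<^sub>R components A c g0 y) has_derivative D)
      (at (ln r, cmap c x0))"
    unfolding differentiable_def by blast
  have "((\<lambda>s. (ln s, cmap c x0)) has_derivative (\<lambda>v. (v / r, 0))) (at r)"
    using assms by (auto intro!: derivative_eq_intros simp: field_simps)
  from has_derivative_compose[OF this D]
  have "((\<lambda>s. \<Psi> (exp (ln s)) *\<^sub>R M) has_derivative (\<lambda>v. D (v / r, 0))) (at r)"
    by (simp add: M_def)
  then have "((\<lambda>s. (\<Psi> (exp (ln s)) *\<^sub>R M) \<bullet> M / (M \<bullet> M)) has_derivative (\<lambda>v. D (v / r, 0) \<bullet> M / (M \<bullet> M))) (at r)"
    by (intro bounded_linear.has_derivative[OF bounded_linear_divide] has_derivative_inner_left)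
  then have "(\<Psi> has_derivative (\<lambda>v. D (v / r, 0) \<bullet> M / (M \<bullet> M))) (at r)"
  proof (rule has_derivative_transform_within_open)
    have "invertible M"
      unfolding M_def using c by (intro components_metric_invertible[OF smooth_M g0]) auto
    then have "M \<noteq> 0" by (rule invertible_nonzero)
    then show "(\<Psi> (exp (ln s)) *\<^sub>R M) \<bullet> M / (M \<bullet> M) = \<Psi> s" if "s \<in> {0<..}" for s
      using that by simp
  qed (use assms in auto)
  then show ?thesis unfolding differentiable_def by blast
qed

lemma \<Psi>_deriv: "r > 0 \<Longrightarrow> (\<Psi> has_field_derivative deriv \<Psi> r) (at r)"
  using \<Psi>_differentiable by (simp add: DERIV_deriv_iff_real_differentiable)

lemma deriv_op_ray:
  assumes "r > 0"
  shows "deriv_op P (mult_g0 r) (mult_g0 a) (mult_g0 b) = mult_g0 (a * b * deriv \<Psi> r)"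
proof
  fix x
  \<comment> \<open>The values of \<open>P\<close> are known on the ray only, that is, as long as \<open>r + t a\<close> is positive.\<close>
  have pos: "open ((\<lambda>t. r + t * a) -` {0<..})" "0 \<in> (\<lambda>t. r + t * a) -` {0<..}"
    using assms by (auto intro!: continuous_open_vimage continuous_intros)
  have "((\<lambda>t. (b * \<Psi> (r + t * a)) *\<^sub>R g0 x) has_vector_derivative (a * b * deriv \<Psi> r) *\<^sub>R g0 x) (at 0)"
  proof -
    have "((\<lambda>t. r + t * a) has_field_derivative a) (at 0)"
      by (auto intro!: derivative_eq_intros)
    then have "((\<lambda>t. \<Psi> (r + t * a)) has_field_derivative deriv \<Psi> r * a) (at 0)"
      using \<Psi>_deriv[OF assms] by (intro DERIV_chain2[where g = "\<lambda>t. r + t * a"]) simp_all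
    then show ?thesis
      by (auto intro!: derivative_eq_intros simp: has_real_derivative_iff_has_vector_derivative algebra_simps)
  qed
  then have "((\<lambda>t. P (\<lambda>z. mult_g0 r z + t *\<^sub>R mult_g0 a z) (mult_g0 b) x)
      has_vector_derivative (a * b * deriv \<Psi> r) *\<^sub>R g0 x) (at 0)"
  proof (rule has_vector_derivative_transform_within_open[OF _ pos])
    show "(b * \<Psi> (r + t * a)) *\<^sub>R g0 x = P (\<lambda>z. mult_g0 r z + t *\<^sub>R mult_g0 a z) (mult_g0 b) x"
      if "t \<in> (\<lambda>t. r + t * a) -` {0<..}" for t
      using that P_mult_g0[of "r + t * a" b] by (simp add: scaleR_add_left)
  qed
  then show "deriv_op P (mult_g0 r) (mult_g0 a) (mult_g0 b) x = (a * b * deriv \<Psi> r) *\<^sub>R g0 x"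
    unfolding deriv_op_def by (rule vector_derivative_at)
qed

text \<open>The coefficient of \<open>g\<^sub>0\<close> in the terms of the geodesic equation that come from varying the pointwise
  inner product and the volume: each of the two products \<open>g\<^sub>t g\<^sup>-\<^sup>1 P g\<^sub>t\<close> contributes \<open>1/2\<close>, and the two traces
  contribute \<open>n/4\<close> and \<open>-n/2\<close>.\<close>

definition metric_terms :: "real \<Rightarrow> real" where
  "metric_terms r = (1 - real CARD('n) / 4) * \<Psi> r / r"

lemma geodesic_rhs_ray:
  assumes "r > 0"
  shows "geodesic_rhs P Q (mult_g0 r) (mult_g0 a)
       = (\<lambda>x. a\<^sup>2 *\<^sub>R ((1/2) *\<^sub>R Q (mult_g0 r) g0 g0 x + metric_terms r *\<^sub>R g0 x))"
proof
  fix x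
  have inv: "invertible (g0 x)" by (rule metric_invertible[OF g0])
  have raise: "matrix_inv (mult_g0 r x) ** mult_g0 b x = (b / r) *\<^sub>R mat 1" for b
    using assms by (simp add: matrix_inv_scaleR[OF inv] matrix_inv_left[OF inv]
        matrix_scalar_ac scalar_matrix_assoc[symmetric])
  have "geodesic_rhs P Q (mult_g0 r) (mult_g0 a) x
      = (1/2) *\<^sub>R (a * a) *\<^sub>R Q (mult_g0 r) g0 g0 x
        + (1/4 * (a / r * (a * \<Psi> r / r * real CARD('n)))) *\<^sub>R mult_g0 r x
        + (1/2) *\<^sub>R (a * \<Psi> r / r) *\<^sub>R mult_g0 a x + (1/2) *\<^sub>R (a / r) *\<^sub>R mult_g0 (a * \<Psi> r) x
        - (1/2 * (a / r * real CARD('n))) *\<^sub>R mult_g0 (a * \<Psi> r) x"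
    unfolding geodesic_rhs_def P_mult_g0[OF assms] Q_mult_g0[OF assms]
    by (simp only: raise matrix_mul_assoc[symmetric])
      (simp only: raise matrix_mul_lid matrix_mul_rid scalar_matrix_assoc[symmetric]
        trace_scaleR trace_I matrix_scalar_ac)
  also have "\<dots> = (1/2 * (a * a)) *\<^sub>R Q (mult_g0 r) g0 g0 x
      + (1/4 * (a / r * (a * \<Psi> r / r * real CARD('n))) * r + 1/2 * (a * \<Psi> r / r) * a
          + 1/2 * (a / r) * (a * \<Psi> r) - 1/2 * (a / r * real CARD('n)) * (a * \<Psi> r)) *\<^sub>R g0 x"
    by (simp only: scaleR_add_left scaleR_diff_left scaleR_scaleR mult.assoc add.assoc add_diff_eq)
  also have "1/4 * (a / r * (a * \<Psi> r / r * real CARD('n))) * r + 1/2 * (a * \<Psi> r / r) * a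
          + 1/2 * (a / r) * (a * \<Psi> r) - 1/2 * (a / r * real CARD('n)) * (a * \<Psi> r)
      = a\<^sup>2 * metric_terms r"
    using assms by (simp add: metric_terms_def field_simps power2_eq_square)
  finally show "geodesic_rhs P Q (mult_g0 r) (mult_g0 a) x
      = a\<^sup>2 *\<^sub>R ((1/2) *\<^sub>R Q (mult_g0 r) g0 g0 x + metric_terms r *\<^sub>R g0 x)"
    by (simp add: scaleR_add_right power2_eq_square)
qed

text \<open>The image under \<open>P\<close> of the acceleration of a geodesic through \<open>r g\<^sub>0\<close> with velocity \<open>g\<^sub>0\<close>.\<close>

definition acceleration_source :: "real \<Rightarrow> ('m, 'n) tensor2" where
  "acceleration_source r = (\<lambda>x. (1/2) *\<^sub>R Q (mult_g0 r) g0 g0 x + (metric_terms r - deriv \<Psi> r) *\<^sub>R g0 x)"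

lemma acceleration_source_sym: "r > 0 \<Longrightarrow> acceleration_source r \<in> sym_fields A"
  unfolding acceleration_source_def
  by (intro sym_fields_add sym_fields_scaleR smooth_M Q_sym_field mult_g0_metric g0_sym)

text \<open>The right-hand side is homogeneous of degree two in the velocity, and \<open>P\<^sup>-\<^sup>1\<close> is linear.\<close>

lemma geodesic_quadratic_ray:
  assumes "r > 0"
  obtains u where "u \<in> sym_fields A" "P (mult_g0 r) u = acceleration_source r"
    "\<And>a. geodesic_quadratic A P Q (mult_g0 r) (mult_g0 a) = (\<lambda>x. a\<^sup>2 *\<^sub>R u x)"
proof -
  note bij = P_bij[OF mult_g0_metric[OF assms]]
  obtain u where u: "u \<in> sym_fields A" "P (mult_g0 r) u = acceleration_source r"
    using bij acceleration_source_sym[OF assms] unfolding bij_betw_def by (metis imageE)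
  have "geodesic_quadratic A P Q (mult_g0 r) (mult_g0 a) = (\<lambda>x. a\<^sup>2 *\<^sub>R u x)" for a
  proof -
    have "(\<lambda>x. geodesic_rhs P Q (mult_g0 r) (mult_g0 a) x - deriv_op P (mult_g0 r) (mult_g0 a) (mult_g0 a) x)
        = (\<lambda>x. a\<^sup>2 *\<^sub>R acceleration_source r x)"
      unfolding geodesic_rhs_ray[OF assms] deriv_op_ray[OF assms] acceleration_source_def
      by (simp add: fun_eq_iff algebra_simps power2_eq_square)
    also have "\<dots> = P (mult_g0 r) (\<lambda>x. a\<^sup>2 *\<^sub>R u x)"
      using P_scaleR[OF mult_g0_metric[OF assms] u(1)] by (simp add: u(2))
    finally show ?thesis
      unfolding geodesic_quadratic_def
      using inv_into_f_f[OF bij_betw_imp_inj_on[OF bij] sym_fields_scaleR[OF smooth_M u(1)]] by simp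
  qed
  with u show ?thesis using that by blast
qed

lemma line_scaleR: "h \<in> line g0 \<Longrightarrow> (\<lambda>x. a *\<^sub>R h x) \<in> line g0"
  unfolding line_def by auto

lemma acceleration_source_line_iff:
  "acceleration_source r \<in> line g0 \<longleftrightarrow> Q (mult_g0 r) g0 g0 \<in> line g0"
proof
  assume "acceleration_source r \<in> line g0"
  then obtain a where "acceleration_source r = mult_g0 a" unfolding line_def by blast
  then have half: "(1/2) *\<^sub>R Q (mult_g0 r) g0 g0 x + (metric_terms r - deriv \<Psi> r) *\<^sub>R g0 x = a *\<^sub>R g0 x" for x
    unfolding acceleration_source_def by (rule fun_cong)
  have "Q (mult_g0 r) g0 g0 x = (2 * (a - (metric_terms r - deriv \<Psi> r))) *\<^sub>R g0 x" for x
  proof -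
    have "(1/2) *\<^sub>R Q (mult_g0 r) g0 g0 x = (a - (metric_terms r - deriv \<Psi> r)) *\<^sub>R g0 x"
      using half[of x] by (simp add: algebra_simps)
    from arg_cong[OF this, of "\<lambda>w. 2 *\<^sub>R w"] show ?thesis by simp
  qed
  then show "Q (mult_g0 r) g0 g0 \<in> line g0" unfolding line_def by blast
next
  assume "Q (mult_g0 r) g0 g0 \<in> line g0"
  then obtain b where "Q (mult_g0 r) g0 g0 = mult_g0 b" unfolding line_def by blast
  then have "acceleration_source r = mult_g0 (b / 2 + (metric_terms r - deriv \<Psi> r))"
    unfolding acceleration_source_def by (simp add: scaleR_add_left)
  then show "acceleration_source r \<in> line g0" unfolding line_def by blast
qed

lemma P_line_iff:
  assumes "r > 0" "u \<in> sym_fields A"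
  shows "P (mult_g0 r) u \<in> line g0 \<longleftrightarrow> u \<in> line g0"
proof
  assume "u \<in> line g0"
  then show "P (mult_g0 r) u \<in> line g0"
    unfolding line_def using P_mult_g0[OF assms(1)] by blast
next
  assume "P (mult_g0 r) u \<in> line g0"
  then obtain a where "P (mult_g0 r) u = mult_g0 a" unfolding line_def by blast
  also have "\<dots> = P (mult_g0 r) (mult_g0 (a / \<Psi> r))"
    using P_mult_g0[OF assms(1)] \<Psi>_nonzero[OF assms(1)] by simp
  finally have "u = mult_g0 (a / \<Psi> r)"
    using P_bij[OF mult_g0_metric[OF assms(1)]] assms(2) mult_g0_sym
    unfolding bij_betw_def inj_on_def by blast
  then show "u \<in> line g0" unfolding line_def by blast
qed

text \<open>With \<open>u\<close> the acceleration at velocity \<open>g\<^sub>0\<close>, polarisation turns \<open>a\<^sup>2 u\<close> into \<open>\<Gamma>(a g\<^sub>0, b g\<^sub>0) = a b u\<close>.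
  Both applying \<open>P\<close> and adding multiples of \<open>g\<^sub>0\<close> preserve and reflect membership in the line.\<close>

lemma totally_geodesic_iff_adjoint_g0:
  "totally_geodesic A P Q (ray g0) (\<lambda>_. line g0) \<longleftrightarrow> (\<forall>r>0. Q (mult_g0 r) g0 g0 \<in> line g0)"
proof -
  have "(\<forall>a b. christoffel_form A P Q (mult_g0 r) (mult_g0 a) (mult_g0 b) \<in> line g0)
      \<longleftrightarrow> Q (mult_g0 r) g0 g0 \<in> line g0" if r: "r > 0" for r
  proof -
    obtain u where u: "u \<in> sym_fields A" "P (mult_g0 r) u = acceleration_source r"
      and quad: "\<And>a. geodesic_quadratic A P Q (mult_g0 r) (mult_g0 a) = (\<lambda>x. a\<^sup>2 *\<^sub>R u x)"
      using geodesic_quadratic_ray[OF r] by blast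
    have "christoffel_form A P Q (mult_g0 r) (mult_g0 a) (mult_g0 b) = (\<lambda>x. (a * b) *\<^sub>R u x)" for a b
      using quad[of "a + b"] quad[of a] quad[of b] unfolding christoffel_form_def
      by (simp add: scaleR_add_left[symmetric] scaleR_diff_left[symmetric] power2_sum)
    moreover have "(\<forall>a b. (\<lambda>x. (a * b) *\<^sub>R u x) \<in> line g0) \<longleftrightarrow> u \<in> line g0"
      using line_scaleR[of u] by (metis (no_types) mult_1 scaleR_one ext)
    ultimately show ?thesis
      using P_line_iff[OF r u(1)] u(2) acceleration_source_line_iff by simp
  qed
  then show ?thesis unfolding totally_geodesic_def in_ray_iff in_line_iff by blast
qed

lemma adjoint_tangential_iff_adjoint_g0:
  "(\<forall>g\<in>ray g0. \<forall>h\<in>line g0. \<forall>k\<in>line g0. Q g h k \<in> line g0)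
     \<longleftrightarrow> (\<forall>r>0. Q (mult_g0 r) g0 g0 \<in> line g0)"
  unfolding in_ray_iff in_line_iff
proof (intro iffI allI impI)
  fix r :: real assume r: "r > 0" and "\<forall>r>0. \<forall>a b. Q (mult_g0 r) (mult_g0 a) (mult_g0 b) \<in> line g0"
  then have "Q (mult_g0 r) (mult_g0 1) (mult_g0 1) \<in> line g0" by blast
  then show "Q (mult_g0 r) g0 g0 \<in> line g0" by simp
next
  fix r a b :: real assume "\<forall>r>0. Q (mult_g0 r) g0 g0 \<in> line g0" "r > 0"
  then show "Q (mult_g0 r) (mult_g0 a) (mult_g0 b) \<in> line g0"
    using line_scaleR Q_mult_g0 by simp
qed

text \<open>Every field is the sum of one normal to \<open>g\<^sub>0\<close> and a multiple of \<open>g\<^sub>0\<close>. Therefore the normal part \<open>m\<close> of \<open>q\<close> is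
  orthogonal not only to the normal fields but to all fields. Testing it with \<open>n\<close>, where \<open>P n = m\<close>, gives
  \<open>\<langle>P n, n\<rangle> = 0\<close>.\<close>

lemma L2_double_normal_line:
  assumes r: "r > 0" and q: "q \<in> sym_fields A"
    and normal: "\<And>m. m \<in> sym_fields A \<Longrightarrow> L2_inner A (mult_g0 r) m g0 = 0 \<Longrightarrow> L2_inner A (mult_g0 r) m q = 0"
  shows "q \<in> line g0"
proof -
  let ?L = "L2_inner A (mult_g0 r)"
  define N where "N = ?L g0 g0"
  have N: "N \<noteq> 0" using \<Psi>_L2_g0_positive[OF r] unfolding N_def by auto
  have add: "?L (\<lambda>x. h x + a *\<^sub>R g0 x) k = ?L h k + a * ?L g0 k"
    if "h \<in> sym_fields A" "k \<in> sym_fields A" for h k a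
    using L2_inner_add_left[OF smooth_M compact_M mult_g0_metric[OF r] that(1) mult_g0_sym that(2)]
    by (simp add: L2_inner_scaleR_left)
  define m where "m = (\<lambda>x. q x + (- (?L g0 q / N)) *\<^sub>R g0 x)"
  have m: "m \<in> sym_fields A" unfolding m_def by (intro sym_fields_add smooth_M q mult_g0_sym)
  have "?L h m = 0" if h: "h \<in> sym_fields A" for h
  proof -
    \<comment> \<open>the part of \<open>h\<close> normal to \<open>g\<^sub>0\<close>, to which the hypothesis applies\<close>
    let ?h = "\<lambda>x. h x + (- (?L h g0 / N)) *\<^sub>R g0 x"
    have "?h \<in> sym_fields A" by (intro sym_fields_add smooth_M h mult_g0_sym)
    moreover have "?L ?h g0 = 0" using N add[OF h g0_sym, of "- (?L h g0 / N)"] by (simp add: N_def)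
    ultimately have "?L ?h q = 0" by (rule normal)
    then have "?L h q = ?L h g0 / N * ?L g0 q" using add[OF h q, of "- (?L h g0 / N)"] by simp
    moreover have "?L h m = ?L h q - ?L g0 q / N * ?L h g0"
      using add[OF q h, of "- (?L g0 q / N)"] unfolding m_def
      by (simp add: L2_inner_commute[of A _ h])
    ultimately show ?thesis by simp
  qed
  moreover obtain n where n: "n \<in> sym_fields A" "P (mult_g0 r) n = m"
    using P_bij[OF mult_g0_metric[OF r]] m unfolding bij_betw_def by (metis imageE)
  ultimately have "?L (P (mult_g0 r) n) n = 0" by (simp add: L2_inner_commute[of A _ m n])
  then have "n = (\<lambda>x. 0)"
    using P_pos_sym[OF mult_g0_metric[OF r]] n(1) unfolding positive_symmetric_op_def by force
  then have "n = mult_g0 0" by simp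
  then have "m = (\<lambda>x. 0)" using n(2) P_mult_g0[OF r, of 0] by simp
  then have "q x = (?L g0 q / N) *\<^sub>R g0 x" for x
    unfolding m_def fun_eq_iff by (drule_tac x = x in spec) simp
  then show ?thesis unfolding line_def by blast
qed

text \<open>By the adjoint property, \<open>\<langle>(D\<^sub>m P) h, k\<rangle> = \<langle>m, (D P h)\<^sup>*(k)\<rangle>\<close>, so that (c) says that \<open>(D P h)\<^sup>*(k)\<close> is orthogonal to
  all fields normal to the line.\<close>

lemma adjoint_tangential_iff_derivative_normal:
  assumes adjoint: "\<forall>g\<in>metrics A. \<forall>h\<in>sym_fields A. \<forall>k\<in>sym_fields A. \<forall>m\<in>sym_fields A.
        L2_inner A g (deriv_op P g m h) k = L2_inner A g m (Q g h k)"
  shows "(\<forall>g\<in>ray g0. \<forall>h\<in>line g0. \<forall>k\<in>line g0. Q g h k \<in> line g0) \<longleftrightarrow>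
    (\<forall>g\<in>ray g0. \<forall>h\<in>line g0. \<forall>m\<in>sym_fields A.
       L2_normal A g (line g0) m \<longrightarrow> L2_normal A g (line g0) (deriv_op P g m h))"
    (is "?b \<longleftrightarrow> ?c")
proof
  assume b: ?b
  show ?c
    unfolding L2_normal_def in_ray_iff
  proof (intro allI impI ballI)
    fix r :: real and h m k
    assume r: "r > 0" and h: "h \<in> line g0" and m: "m \<in> sym_fields A" and k: "k \<in> line g0"
      and normal: "\<forall>k\<in>line g0. L2_inner A (mult_g0 r) m k = 0"
    have "h \<in> sym_fields A" "k \<in> sym_fields A" using h k mult_g0_sym unfolding line_def by auto
    then have "L2_inner A (mult_g0 r) (deriv_op P (mult_g0 r) m h) k
        = L2_inner A (mult_g0 r) m (Q (mult_g0 r) h k)"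
      using adjoint mult_g0_metric[OF r] m by blast
    also have "\<dots> = 0" using normal b h k r unfolding in_ray_iff by blast
    finally show "L2_inner A (mult_g0 r) (deriv_op P (mult_g0 r) m h) k = 0" .
  qed
next
  assume c: ?c
  show ?b
    unfolding in_ray_iff
  proof (intro allI impI ballI)
    fix r :: real and h k
    assume r: "r > 0" and h: "h \<in> line g0" and k: "k \<in> line g0"
    have hk: "h \<in> sym_fields A" "k \<in> sym_fields A" using h k mult_g0_sym unfolding line_def by auto
    show "Q (mult_g0 r) h k \<in> line g0"
    proof (rule L2_double_normal_line[OF r Q_sym_field[OF mult_g0_metric[OF r] hk]])
      fix m assume m: "m \<in> sym_fields A" "L2_inner A (mult_g0 r) m g0 = 0"
      then have "L2_normal A (mult_g0 r) (line g0) m"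
        unfolding L2_normal_def in_line_iff by (simp add: L2_inner_scaleR_right)
      then have "L2_inner A (mult_g0 r) (deriv_op P (mult_g0 r) m h) k = 0"
        using c r h k m(1) unfolding L2_normal_def in_ray_iff by blast
      then show "L2_inner A (mult_g0 r) m (Q (mult_g0 r) h k) = 0"
        using adjoint mult_g0_metric[OF r] m(1) hk by simp
    qed
  qed
qed

lemma velocity_ray:
  assumes "r differentiable (at t)"
  shows "velocity (\<lambda>t. mult_g0 (r t)) t = mult_g0 (deriv r t)"
proof
  show "velocity (\<lambda>t. mult_g0 (r t)) t x = mult_g0 (deriv r t) x" for x
    unfolding velocity_def
    using assms by (intro vector_derivative_at has_vector_derivative_scaleR_fixed)
      (simp add: DERIV_deriv_iff_real_differentiable)
qed

text \<open>The momentum is \<open>P g\<^sub>t = r' \<Psi>(r) g\<^sub>0\<close>, with derivative \<open>(r'' \<Psi>(r) + r'\<^sup>2 \<Psi>'(r)) g\<^sub>0\<close>. As \<open>g\<^sub>0\<close> vanishes at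
  no point, the geodesic equation at any single point is equivalent to the scalar equation.\<close>

lemma geodesic_on_ray_iff:
  assumes I: "open I" and smooth: "smooth_on I r" and pos: "\<And>t. t \<in> I \<Longrightarrow> r t > 0"
    and f: "\<And>s. s > 0 \<Longrightarrow> Q (mult_g0 s) g0 g0 = mult_g0 (f s)"
  shows "is_geodesic A P Q I (\<lambda>t. mult_g0 (r t)) \<longleftrightarrow>
    (\<forall>t\<in>I. deriv (deriv r) t * \<Psi> (r t) =
       (deriv r t)\<^sup>2 * (1/2 * f (r t) - deriv \<Psi> (r t) + (1 - real CARD('n) / 4) * \<Psi> (r t) / r t))"
proof -
  let ?g = "\<lambda>t. mult_g0 (r t)"
  have r': "(r has_field_derivative deriv r t) (at t)" if "t \<in> I" for t
    using smooth_on_differentiable[OF smooth that] by (simp add: DERIV_deriv_iff_real_differentiable)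
  have r'': "(deriv r has_field_derivative deriv (deriv r) t) (at t)" if "t \<in> I" for t
  proof -
    have "frechet_derivative r (at s) 1 = deriv r s" if "s \<in> I" for s
      using fun_cong[OF frechet_derivative_at[OF r'[OF that, unfolded has_field_derivative_def]], of 1]
      by simp
    from differentiable_cong_open[OF I that this
        smooth_on_differentiable[OF smooth_on_directional_derivative[OF smooth] that]]
    have "deriv r differentiable (at t)" .
    then show ?thesis by (simp add: DERIV_deriv_iff_real_differentiable)
  qed
  have momentum: "((\<lambda>s. P (?g s) (velocity ?g s) x) has_vector_derivative
      (deriv (deriv r) t * \<Psi> (r t) + (deriv r t)\<^sup>2 * deriv \<Psi> (r t)) *\<^sub>R g0 x) (at t)" if "t \<in> I" for t x
  proof (rule has_vector_derivative_transform_within_open[OF _ I that])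
    have "((\<lambda>s. \<Psi> (r s)) has_field_derivative deriv \<Psi> (r t) * deriv r t) (at t)"
      by (rule DERIV_chain2[OF \<Psi>_deriv[OF pos[OF that]] r'[OF that]])
    from DERIV_mult[OF r''[OF that] this]
    show "((\<lambda>s. (deriv r s * \<Psi> (r s)) *\<^sub>R g0 x) has_vector_derivative
        (deriv (deriv r) t * \<Psi> (r t) + (deriv r t)\<^sup>2 * deriv \<Psi> (r t)) *\<^sub>R g0 x) (at t)"
      by (intro has_vector_derivative_scaleR_fixed) (simp add: algebra_simps power2_eq_square)
    show "(deriv r s * \<Psi> (r s)) *\<^sub>R g0 x = P (?g s) (velocity ?g s) x" if "s \<in> I" for s
      using P_mult_g0[OF pos[OF that]] velocity_ray smooth_on_differentiable[OF smooth that] by simp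
  qed
  have "((\<lambda>s. P (?g s) (velocity ?g s) x) has_vector_derivative
        geodesic_rhs P Q (?g t) (velocity ?g t) x) (at t) \<longleftrightarrow>
      deriv (deriv r) t * \<Psi> (r t) =
        (deriv r t)\<^sup>2 * (1/2 * f (r t) - deriv \<Psi> (r t) + (1 - real CARD('n) / 4) * \<Psi> (r t) / r t)"
    if t: "t \<in> I" for t x
  proof -
    have rhs: "geodesic_rhs P Q (?g t) (velocity ?g t) x
        = ((deriv r t)\<^sup>2 * (1/2 * f (r t) + metric_terms (r t))) *\<^sub>R g0 x"
      using pos[OF t] velocity_ray smooth_on_differentiable[OF smooth t]
      by (simp add: geodesic_rhs_ray f scaleR_add_left algebra_simps)
    let ?acc = "deriv (deriv r) t * \<Psi> (r t) + (deriv r t)\<^sup>2 * deriv \<Psi> (r t)"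
    have "((\<lambda>s. P (?g s) (velocity ?g s) x) has_vector_derivative R) (at t) \<longleftrightarrow> ?acc *\<^sub>R g0 x = R" for R
      by (rule iffI, erule vector_derivative_unique_at[OF momentum[OF t]])
        (erule subst, rule momentum[OF t])
    moreover have "?acc *\<^sub>R g0 x = b *\<^sub>R g0 x \<longleftrightarrow> ?acc = b" for b
      using g0_nonzero[of x] by simp
    ultimately show ?thesis
      unfolding rhs metric_terms_def by (simp only:) (auto simp: algebra_simps)
  qed
  moreover have "smooth_curve A I ?g" by (rule smooth_curve_scaleR[OF smooth_M I smooth g0_sym])
  ultimately show ?thesis
    unfolding is_geodesic_def using pos mult_g0_metric by auto
qed

text \<open>A constant multiple of \<open>g\<^sub>0\<close> is a constant multiple of the metric \<open>s g\<^sub>0\<close>, hence parallel.\<close>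

lemma nabla_star_vol_ray:
  assumes "s > 0" "c \<in> A" "y \<in> cimage c"
  shows "nabla_star_vol A c (mult_g0 s) (mult_g0 b) y j = 0"
proof -
  let ?G = "components A c (mult_g0 s)"
  have "components A c (mult_g0 b) = (\<lambda>z. (b / s) *\<^sub>R ?G z)"
    using assms(1) by (simp add: components_scaleR)
  moreover have "?G differentiable (at y)"
    using mult_g0_sym assms(2,3) unfolding sym_fields_def by (auto intro: smooth_on_differentiable)
  moreover have "nabla ?G ?G y k i j = 0" for k i
    using components_symmetric[OF mult_g0_sym]
      components_metric_invertible[OF smooth_M mult_g0_metric[OF assms(1)] assms(2,3)]
    by (rule nabla_metric)
  ultimately show ?thesis unfolding nabla_star_vol_def by (simp add: nabla_scaleR)
qed

end

theorem lemma3p4: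
  fixes A :: "('m::t2_space, 'n::finite) chart set"
    and P :: "('m, 'n) tensor2 \<Rightarrow> ('m, 'n) tensor2 \<Rightarrow> ('m, 'n) tensor2"
    and Q :: "('m, 'n) tensor2 \<Rightarrow> ('m, 'n) tensor2 \<Rightarrow> ('m, 'n) tensor2 \<Rightarrow> ('m, 'n) tensor2"
    and p :: real
    and g0 :: "('m, 'n) tensor2"
  assumes compact_M: "compact (UNIV :: 'm set)"
    and smooth_M: "smooth_structure A"
    and order: "0 \<le> p"
    and pseudo: "\<forall>g\<in>metrics A. pseudo_diff_op A (2 * p) (P g)"
    and pos_sym: "\<forall>g\<in>metrics A. positive_symmetric_op A g (P g)"
    and bijective: "\<forall>g\<in>metrics A. bij_betw (P g) (sym_fields A) (sym_fields A)"
    and smooth_P: "smooth_operator_family A P"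
    and smooth_Q: "smooth_bilinear_family A Q"
    and adjoint: "\<forall>g\<in>metrics A. \<forall>h\<in>sym_fields A. \<forall>k\<in>sym_fields A. \<forall>m\<in>sym_fields A.
        L2_inner A g (deriv_op P g m h) k = L2_inner A g m (Q g h k)"
    and g0: "g0 \<in> metrics A"
    and restricts: "\<forall>g\<in>ray g0. \<forall>h\<in>line g0. P g h \<in> line g0"
  shows "let a = totally_geodesic A P Q (ray g0) (\<lambda>_. line g0);
             b = (\<forall>g\<in>ray g0. \<forall>h\<in>line g0. \<forall>k\<in>line g0. Q g h k \<in> line g0);
             c = (\<forall>g\<in>ray g0. \<forall>h\<in>line g0. \<forall>m\<in>sym_fields A.
                    L2_normal A g (line g0) m \<longrightarrow> L2_normal A g (line g0) (deriv_op P g m h));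
             scalars = (\<lambda>\<Psi> f :: real \<Rightarrow> real. \<forall>r>0.
                    P (\<lambda>x. r *\<^sub>R g0 x) g0 = (\<lambda>x. \<Psi> r *\<^sub>R g0 x) \<and>
                    Q (\<lambda>x. r *\<^sub>R g0 x) g0 g0 = (\<lambda>x. f r *\<^sub>R g0 x))
         in (a \<longleftrightarrow> b) \<and> (b \<longleftrightarrow> c) \<and>
            (a \<and> b \<and> c \<longrightarrow>
              (\<exists>\<Psi> f. scalars \<Psi> f) \<and>
              (\<forall>\<Psi> f. scalars \<Psi> f \<longrightarrow>
                 (\<forall>r>0. \<Psi> differentiable (at r)) \<and>
                 (\<forall>I r. open I \<and> is_interval I \<and> smooth_on I r \<and> (\<forall>t\<in>I. r t > 0) \<longrightarrow>
                    (is_geodesic A P Q I (\<lambda>t x. r t *\<^sub>R g0 x) \<longleftrightarrow>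
                       (\<forall>t\<in>I. deriv (deriv r) t * \<Psi> (r t) =
                          (deriv r t)\<^sup>2 * (1/2 * f (r t) - deriv \<Psi> (r t)
                             + (1 - real CARD('n) / 4) * \<Psi> (r t) / r t))) \<and>
                    (is_geodesic A P Q I (\<lambda>t x. r t *\<^sub>R g0 x) \<longrightarrow>
                       (\<forall>t\<in>I. \<forall>c\<in>A. \<forall>y\<in>cimage c. \<forall>j.
                          nabla_star_vol A c (\<lambda>x. r t *\<^sub>R g0 x)
                            (P (\<lambda>x. r t *\<^sub>R g0 x) (velocity (\<lambda>t x. r t *\<^sub>R g0 x) t)) y j = 0)))))"
proof -
  have "g0 \<in> line g0" unfolding line_def by (auto intro: exI[of _ 1])
  then have "\<forall>r>0. \<exists>a. P (\<lambda>x. r *\<^sub>R g0 x) g0 = (\<lambda>x. a *\<^sub>R g0 x)"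
    using restricts unfolding ray_def line_def by blast
  then obtain \<Psi>0 where \<Psi>0: "\<forall>r>0. P (\<lambda>x. r *\<^sub>R g0 x) g0 = (\<lambda>x. \<Psi>0 r *\<^sub>R g0 x)"
    by metis
  have on_ray: "operator_on_ray A P Q g0 \<Psi>" if "\<forall>r>0. P (\<lambda>x. r *\<^sub>R g0 x) g0 = (\<lambda>x. \<Psi> r *\<^sub>R g0 x)" for \<Psi>
    by unfold_locales
      (use compact_M smooth_M pseudo pos_sym bijective smooth_P smooth_Q g0 that in \<open>auto simp: pseudo_diff_op_def\<close>)
  interpret R0: operator_on_ray A P Q g0 \<Psi>0 using on_ray[OF \<Psi>0] .
  note ab = R0.totally_geodesic_iff_adjoint_g0 R0.adjoint_tangential_iff_adjoint_g0
  note bc = R0.adjoint_tangential_iff_derivative_normal[OF adjoint]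
  have ex: "\<exists>\<Psi> f. \<forall>r>0. P (\<lambda>x. r *\<^sub>R g0 x) g0 = (\<lambda>x. \<Psi> r *\<^sub>R g0 x)
      \<and> Q (\<lambda>x. r *\<^sub>R g0 x) g0 g0 = (\<lambda>x. f r *\<^sub>R g0 x)"
    if "\<forall>r>0. Q (\<lambda>x. r *\<^sub>R g0 x) g0 g0 \<in> line g0"
  proof -
    have "\<forall>r. \<exists>b. r > 0 \<longrightarrow> Q (\<lambda>x. r *\<^sub>R g0 x) g0 g0 = (\<lambda>x. b *\<^sub>R g0 x)"
      using that unfolding line_def by blast
    from choice[OF this] \<Psi>0 show ?thesis by blast
  qed
  show ?thesis
    unfolding Let_def
  proof (intro conjI impI allI)
    show "totally_geodesic A P Q (ray g0) (\<lambda>_. line g0) \<longleftrightarrow>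
        (\<forall>g\<in>ray g0. \<forall>h\<in>line g0. \<forall>k\<in>line g0. Q g h k \<in> line g0)"
      unfolding ab ..
  next
    fix \<Psi> f r
    assume "\<forall>r>0. P (\<lambda>x. r *\<^sub>R g0 x) g0 = (\<lambda>x. \<Psi> r *\<^sub>R g0 x)
      \<and> Q (\<lambda>x. r *\<^sub>R g0 x) g0 g0 = (\<lambda>x. f r *\<^sub>R g0 x)"
    then interpret operator_on_ray A P Q g0 \<Psi> using on_ray by blast
    show "\<Psi> differentiable (at r)" if "r > 0" using \<Psi>_differentiable that .
  next
    fix \<Psi> f r :: "real \<Rightarrow> real" and I
    assume scalars: "\<forall>r>0. P (\<lambda>x. r *\<^sub>R g0 x) g0 = (\<lambda>x. \<Psi> r *\<^sub>R g0 x)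
        \<and> Q (\<lambda>x. r *\<^sub>R g0 x) g0 g0 = (\<lambda>x. f r *\<^sub>R g0 x)"
      and r: "open I \<and> is_interval I \<and> smooth_on I r \<and> (\<forall>t\<in>I. r t > 0)"
    interpret operator_on_ray A P Q g0 \<Psi> using on_ray scalars by blast
    show "is_geodesic A P Q I (\<lambda>t x. r t *\<^sub>R g0 x) \<longleftrightarrow>
        (\<forall>t\<in>I. deriv (deriv r) t * \<Psi> (r t) = (deriv r t)\<^sup>2 *
           (1/2 * f (r t) - deriv \<Psi> (r t) + (1 - real CARD('n) / 4) * \<Psi> (r t) / r t))"
      using geodesic_on_ray_iff[of I r f] r scalars by blast
    show "\<forall>t\<in>I. \<forall>c\<in>A. \<forall>y\<in>cimage c. \<forall>j. nabla_star_vol A c (\<lambda>x. r t *\<^sub>R g0 x)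
        (P (\<lambda>x. r t *\<^sub>R g0 x) (velocity (\<lambda>t x. r t *\<^sub>R g0 x) t)) y j = 0"
    proof (intro ballI allI)
      fix t c y j assume "t \<in> I" "c \<in> A" "y \<in> cimage c"
      moreover from this have "velocity (\<lambda>t x. r t *\<^sub>R g0 x) t = (\<lambda>x. deriv r t *\<^sub>R g0 x)"
        using r smooth_on_differentiable by (intro velocity_ray) blast
      ultimately show "nabla_star_vol A c (\<lambda>x. r t *\<^sub>R g0 x)
          (P (\<lambda>x. r t *\<^sub>R g0 x) (velocity (\<lambda>t x. r t *\<^sub>R g0 x) t)) y j = 0"
        using r P_mult_g0 nabla_star_vol_ray by simp
    qed
  qed (use ab bc ex in blast)+
qed

end
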